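(* Let $0<p,\alpha<\infty$, let $w\in A_\infty$ be a Muckenhoupt weight on $\mathbb{C}$, and let $G\subset\mathbb{C}$ be a measurable set. Then $G$ is a dominating set for the weighted Fock space $F^p_{\alpha,w}$ if and only if there exist $R>0$ and $\delta\in(0,1)$ such that for all $a\in\mathbb{C}$, $$w\big(G\cap D(a,R)\big)>\delta\, w\big(D(a,R)\big).$$
   Context: $dA$ is Lebesgue measure on $\mathbb{C}$, and $D(a,R)$ is the Euclidean disk with center $a$ and radius $R$. A weight is a non-negative locally integrable function $w$ on $\mathbb{C}$, and $w(E):=\int_E w\,dA$ for measurable $E$. Squares $Q\subset\mathbb{C}$ have sides parallel to the coordinate axes. For $1<p<\infty$ with conjugate exponent $p'$ ($1/p+1/p'=1$), $A_p$ is the class of weights $w$ with $$\sup_{Q}\Big(\frac{1}{A(Q)}\int_{Q}w\,dA\Big)\Big(\frac{1}{A(Q)}\int_{Q}w^{-p'/p}dA\Big)^{p/p'}<\infty,$$ and $A_1$ is the class of weights with $\sup_Q\big(\frac{1}{A(Q)}\int_Q w\,dA\big)\|w^{-1}\|_{L^\infty(Q)}<\infty$, the suprema being over all squares $Q$ (convention $0\cdot\infty=\infty$, so $w>0$ a.e.). $A_\infty:=\bigcup_{1\le p<\infty}A_p$. $F^p_{\alpha,w}$ is the space of entire functions $f$ on $\mathbb{C}$ with $\|f\|^p_{F^p_{\alpha,w}}:=\int_{\mathbb{C}}|f(z)|^pe^{-\frac{p\alpha}{2}|z|^2}w(z)\,dA(z)<\infty$. A measurable set $G$ is a dominating set for $F^p_{\alpha,w}$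 if there is $C>0$ such that $\|f\|^p_{F^p_{\alpha,w}}\le C\int_{G}|f(z)|^pe^{-\frac{p\alpha}{2}|z|^2}w(z)\,dA(z)$ for all $f\in F^p_{\alpha,w}$. *)

theory Defs
  imports "HOL-Probability.Essential_Supremum" "HOL-Complex_Analysis.Complex_Analysis"
begin

definition weight :: "(complex \<Rightarrow> real) \<Rightarrow> bool" where
  "weight w \<longleftrightarrow> (\<forall>z. 0 \<le> w z) \<and> w \<in> borel_measurable lebesgue \<and>
     (\<forall>K. compact K \<longrightarrow> set_integrable lebesgue K w)"

definition wmeasure :: "(complex \<Rightarrow> real) \<Rightarrow> complex set \<Rightarrow> ennreal" where
  "wmeasure w E = (\<integral>\<^sup>+ z \<in> E. ennreal (w z) \<partial>lebesgue)"

definition squares :: "complex set set" where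
  "squares = {cbox c (c + Complex s s) | c s. 0 < s}"

definition average :: "complex set \<Rightarrow> (complex \<Rightarrow> ennreal) \<Rightarrow> ennreal" where
  "average Q g = (\<integral>\<^sup>+ z \<in> Q. g z \<partial>lebesgue) / emeasure lebesgue Q"

(* Multiplication on [0,\<infinity>] with 0 * \<infinity> = \<infinity>, the convention in the Muckenhoupt conditions;
   the library's product on ennreal has 0 * \<infinity> = 0, under which w = 0 would be in every A_p. *)
definition mult_top :: "ennreal \<Rightarrow> ennreal \<Rightarrow> ennreal" where
  "mult_top x y = (if x = top \<or> y = top then top else x * y)"

(* x^r on [0,\<infinity>]; used for r > 0 only. *)
definition ennpowr :: "ennreal \<Rightarrow> real \<Rightarrow> ennreal" where
  "ennpowr x r = (if x = top then top else ennreal (enn2real x powr r))"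

definition conj_exp :: "real \<Rightarrow> real" where
  "conj_exp p = p / (p - 1)"

lemma conj_exp: "1 < p \<Longrightarrow> 1 / p + 1 / conj_exp p = 1"
  by (simp add: conj_exp_def field_simps)

(* Negative powers of w are taken in [0,\<infinity>] as inverses, so that they are \<infinity> where w = 0. *)
definition Muckenhoupt :: "real \<Rightarrow> (complex \<Rightarrow> real) set" where
  "Muckenhoupt p =
     (if p = 1 then
        {w. weight w \<and>
            (SUP Q\<in>squares. mult_top (average Q (\<lambda>z. ennreal (w z)))
               (esssup (restrict_space lebesgue Q) (\<lambda>z. inverse (ennreal (w z))))) < top}
      else
        {w. weight w \<and>
            (SUP Q\<in>squares. mult_top (average Q (\<lambda>z. ennreal (w z)))
               (ennpowr (average Q (\<lambda>z. inverse (ennreal (w z powr (conj_exp p / p)))))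
                  (p / conj_exp p))) < top})"

definition Muckenhoupt_infinity :: "(complex \<Rightarrow> real) set" where
  "Muckenhoupt_infinity = (\<Union>p\<in>{1..}. Muckenhoupt p)"

definition fock_integral ::
  "real \<Rightarrow> real \<Rightarrow> (complex \<Rightarrow> real) \<Rightarrow> complex set \<Rightarrow> (complex \<Rightarrow> complex) \<Rightarrow> ennreal" where
  "fock_integral p \<alpha> w E f =
     (\<integral>\<^sup>+ z \<in> E. ennreal (norm (f z) powr p * exp (- (p * \<alpha> / 2) * (norm z)\<^sup>2) * w z) \<partial>lebesgue)"

definition fock_space :: "real \<Rightarrow> real \<Rightarrow> (complex \<Rightarrow> real) \<Rightarrow> (complex \<Rightarrow> complex) set" where
  "fock_space p \<alpha> w = {f. f holomorphic_on UNIV \<and> fock_integral p \<alpha> w UNIV f < top}"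

definition dominating_set :: "real \<Rightarrow> real \<Rightarrow> (complex \<Rightarrow> real) \<Rightarrow> complex set \<Rightarrow> bool" where
  "dominating_set p \<alpha> w G \<longleftrightarrow> G \<in> sets lebesgue \<and>
     (\<exists>C>0. \<forall>f\<in>fock_space p \<alpha> w.
        fock_integral p \<alpha> w UNIV f \<le> ennreal C * fock_integral p \<alpha> w G f)"

end

theory Submission
  imports Defs "HOL-Real_Asymp.Real_Asymp"
begin

text \<open>
  Everything about \<open>w\<close> is derived from one consequence of the Muckenhoupt condition, the comparison
  \<open>w(E) \<ge> c (|E| / r\<^sup>2)\<^sup>q w(D(a,r))\<close> for \<open>E \<subseteq> D(a,r)\<close>; reverse Hoelder inequalities are not needed.
  It gives doubling and, applied to annuli, \<open>w(D(b, \<eta> r)) \<le> \<epsilon> w(D(b, r))\<close> for small \<open>\<eta>\<close>.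

  Sufficiency: let \<open>u = |f|\<^sup>p e\<^bsup>-p\<alpha>|z|\<^sup>2/2\<^esup>\<close>, which on \<open>D(a,3R)\<close> is comparable to \<open>|F|\<^sup>p\<close> for an entire
  \<open>F\<close>. If \<open>\<integral>\<close> of \<open>u\<close> over \<open>D(a,R)\<close> is not dominated by \<open>1/K\<close> times the integral over \<open>D(a,3R)\<close>, then a
  weighted mean value inequality bounds \<open>F\<close> on \<open>D(a,2R)\<close> by a multiple of its maximum on \<open>D(a,R)\<close>. By a
  normal families argument such an \<open>F\<close> can be small only near finitely many points, hence on a set of
  small \<open>w\<close>-measure, so that \<open>G\<close> captures a fixed proportion of the integral. Averaging the resulting
  local inequality over all \<open>a\<close> and absorbing the first term gives the global one.

  Necessity: test with the normalized reproducing kernels, for which \<open>u\<close> is the Gaussian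
  \<open>e\<^bsup>-p\<alpha>|z-a|\<^sup>2/2\<^esup>\<close>; by doubling its tail is small compared with \<open>w(D(a,1))\<close>.
\<close>

subsection \<open>Comparison of measures for Muckenhoupt weights\<close>

text \<open>Integrated over a set and optimized in \<open>t\<close>, this replaces Hoelder's inequality.\<close>

lemma one_le_mult_plus_powr:
  fixes x s :: real
  assumes "0 \<le> x" "0 < t" "0 < s"
  shows "1 \<le> ennreal t * ennreal x + ennreal (t powr (- s)) * inverse (ennreal (x powr s))"
proof (cases "t * x \<ge> 1")
  case True
  then have "1 \<le> ennreal (t * x)" by simp
  then show ?thesis using assms by (simp add: ennreal_mult add_increasing2)
next
  case False
  show ?thesis
  proof (cases "x = 0")
    case True
    then show ?thesis using assms by (simp add: ennreal_mult_top)
  next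
    case x: False
    then have x0: "x > 0" using assms by simp
    have "(t * x) powr s \<le> 1"
      using False assms by (intro powr_le1) auto
    then have "1 \<le> (t * x) powr (- s)"
      unfolding powr_minus using x0 assms by (intro one_le_inverse) auto
    also have "(t * x) powr (- s) = t powr (- s) * inverse (x powr s)"
      unfolding powr_mult powr_minus[of x s] ..
    finally have "1 \<le> ennreal (t powr (- s) * inverse (x powr s))" by simp
    also have "\<dots> = ennreal (t powr (- s)) * inverse (ennreal (x powr s))"
      using x0 by (simp add: ennreal_mult inverse_ennreal)
    finally show ?thesis by (simp add: add_increasing)
  qed
qed

lemma wmeasure_eq_emeasure:
  assumes "weight w" "E \<in> sets lebesgue"
  shows "wmeasure w E = emeasure (density lebesgue (\<lambda>z. ennreal (w z))) E"
proof -
  have [measurable]: "w \<in> borel_measurable lebesgue" using assms(1) by (simp add: weight_def)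
  show ?thesis
    unfolding wmeasure_def using assms(2) by (simp add: emeasure_density)
qed

lemma wmeasure_finite:
  assumes "weight w" "bounded E" "E \<in> sets lebesgue"
  shows "wmeasure w E < top"
proof -
  obtain r where r: "E \<subseteq> cball 0 r"
    using assms(2) using bounded_subset_ballD[OF assms(2), of 0] ball_subset_cball by blast
  have i: "set_integrable lebesgue (cball 0 r) w" and nn: "\<And>z. 0 \<le> w z"
    using assms(1) by (auto simp: weight_def)
  have "wmeasure w E \<le> wmeasure w (cball 0 r)"
    unfolding wmeasure_def using r by (intro nn_integral_mono) (auto split: split_indicator)
  also have "\<dots> = (\<integral>\<^sup>+z. ennreal (norm (indicator (cball 0 r) z *\<^sub>R w z)) \<partial>lebesgue)"
    unfolding wmeasure_def using nn by (intro nn_integral_cong) (auto split: split_indicator)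
  also have "\<dots> < top"
    using i unfolding set_integrable_def integrable_iff_bounded by (simp add: top.not_eq_extremum)
  finally show ?thesis .
qed

lemma wmeasure_mono: "E \<subseteq> F \<Longrightarrow> wmeasure w E \<le> wmeasure w F"
  unfolding wmeasure_def by (intro nn_integral_mono) (auto split: split_indicator)

text \<open>For p = 1, |E| is at most the essential supremum of 1/w over Q times w(E). For p > 1,
  \<open>one_le_mult_plus_powr\<close> plays the part of Hoelder's inequality and bounds |E| by w(E)
  and the integral of the dual weight over Q. The factor 2 is the price of optimizing in t; the case
  p = 1 carries it along so that both cases yield one statement. Since squares are bounded and w is
  locally integrable, \<open>enn2real\<close> loses nothing.\<close>

lemma Muckenhoupt_square:
  assumes w: "w \<in> Muckenhoupt p" and p: "1 \<le> p"
  obtains K where "0 < K"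
    "\<And>Q E. Q \<in> squares \<Longrightarrow> E \<in> sets lebesgue \<Longrightarrow> E \<subseteq> Q \<Longrightarrow> 0 < measure lebesgue E \<Longrightarrow>
      0 < enn2real (wmeasure w E) \<and>
      (measure lebesgue E / (2 * measure lebesgue Q)) powr p * enn2real (wmeasure w Q)
        \<le> K * enn2real (wmeasure w E)"
proof -
  have wt: "weight w" using w by (auto simp: Muckenhoupt_def split: if_splits)
  then have nn: "\<And>z. 0 \<le> w z" and meas [measurable]: "w \<in> borel_measurable lebesgue"
    by (auto simp: weight_def)
  have squareD: "Q \<in> sets lebesgue" "bounded Q" "0 < measure lebesgue Q"
      "emeasure lebesgue Q = ennreal (measure lebesgue Q)" if Q: "Q \<in> squares" for Q
  proof -
    obtain c s where Qs: "Q = cbox c (c + Complex s s)" "0 < s"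
      using Q by (auto simp: squares_def)
    show "Q \<in> sets lebesgue" "bounded Q" using Qs by auto
    have "measure lborel Q = s * s"
      using Qs by (simp add: content_cbox_if box_eq_empty Basis_complex_def)
    then show "0 < measure lebesgue Q" using Qs by simp
    show "emeasure lebesgue Q = ennreal (measure lebesgue Q)"
      using Qs by (simp add: emeasure_eq_measure2 emeasure_lborel_cbox_finite)
  qed
  have fin: "wmeasure w E = ennreal (enn2real (wmeasure w E))"
    if "bounded E" "E \<in> sets lebesgue" for E
    using wmeasure_finite[OF wt that] by simp
  have avg: "average Q (\<lambda>z. ennreal (w z)) = ennreal (enn2real (wmeasure w Q) / measure lebesgue Q)"
    if Q: "Q \<in> squares" for Q
  proof -
    have "average Q (\<lambda>z. ennreal (w z)) = wmeasure w Q / emeasure lebesgue Q"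
      by (simp add: average_def wmeasure_def)
    also have "\<dots> = ennreal (enn2real (wmeasure w Q)) / ennreal (measure lebesgue Q)"
      using fin[of Q] squareD[OF Q] by simp
    finally show ?thesis using squareD[OF Q] by (simp add: divide_ennreal)
  qed
  show ?thesis
  proof (cases "p = 1")
    case True
    define S where "S Q = esssup (restrict_space lebesgue Q) (\<lambda>z. inverse (ennreal (w z)))" for Q
    obtain K0 where K0: "(SUP Q\<in>squares. mult_top (average Q (\<lambda>z. ennreal (w z))) (S Q)) = ennreal K0"
        "0 \<le> K0"
    proof -
      have "(SUP Q\<in>squares. mult_top (average Q (\<lambda>z. ennreal (w z))) (S Q)) < top"
        using w True unfolding Muckenhoupt_def S_def by simp
      then show ?thesis using that by (cases rule: ennreal_cases) auto
    qed
    show ?thesis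
    \<comment> \<open>\<open>K0\<close> is only known to be nonnegative; adding 1 makes the constant
      positive.\<close>
    proof (rule that[of "K0 + 1"])
      show "0 < K0 + 1" using K0 by simp
      fix Q E assume Q: "Q \<in> squares" and E: "E \<in> sets lebesgue" "E \<subseteq> Q" "0 < measure lebesgue E"
      note sq = squareD[OF Q]
      have bE: "bounded E" using E sq bounded_subset by blast
      have "mult_top (average Q (\<lambda>z. ennreal (w z))) (S Q) \<le> ennreal K0"
        unfolding K0(1)[symmetric] using Q by (intro SUP_upper)
      \<comment> \<open>\<open>mult_top\<close> is infinite as soon as one factor is, so the
        essential supremum is finite even if the average of w over Q were 0. This is where the
        convention for 0 times infinity enters.\<close>
      then have St: "S Q \<noteq> top" and le: "average Q (\<lambda>z. ennreal (w z)) * S Q \<le> ennreal K0"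
        by (auto simp: mult_top_def top_unique split: if_splits)
      obtain s where s: "S Q = ennreal s" "0 \<le> s" using St by (cases "S Q") auto
      have "AE z in restrict_space lebesgue Q. inverse (ennreal (w z)) \<le> ennreal s"
        using esssup_AE[of "\<lambda>z. inverse (ennreal (w z))" "restrict_space lebesgue Q"] s
        by (simp add: S_def)
      then have ae: "AE z in lebesgue. z \<in> Q \<longrightarrow> inverse (ennreal (w z)) \<le> ennreal s"
        using sq by (subst (asm) AE_restrict_space_iff) auto
      have "emeasure lebesgue E = (\<integral>\<^sup>+z. indicator E z \<partial>lebesgue)"
        using E by simp
      also have "\<dots> \<le> (\<integral>\<^sup>+z. ennreal s * (ennreal (w z) * indicator E z) \<partial>lebesgue)"
      proof (rule nn_integral_mono_AE, use ae in eventually_elim)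
        fix z assume z: "z \<in> Q \<longrightarrow> inverse (ennreal (w z)) \<le> ennreal s"
        show "indicator E z \<le> ennreal s * (ennreal (w z) * indicator E z)"
        proof (cases "z \<in> E")
          case True
          then have i: "inverse (ennreal (w z)) \<le> ennreal s" using E z by auto
          then have "w z \<noteq> 0" by (auto simp: top_unique)
          then have "w z > 0" using nn[of z] by simp
          then have "inverse (w z) \<le> s" using i s by (simp add: inverse_ennreal)
          then have "1 \<le> s * w z" using \<open>w z > 0\<close> by (simp add: field_simps)
          then show ?thesis using True s nn by (simp add: ennreal_mult[symmetric])
        qed auto
      qed
      also have "\<dots> = ennreal s * wmeasure w E"
        unfolding wmeasure_def using E by (intro nn_integral_cmult) auto
      also have "\<dots> = ennreal (s * enn2real (wmeasure w E))"
        using s by (subst fin[OF bE E(1)]) (simp add: ennreal_mult)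
      finally have "emeasure lebesgue E \<le> ennreal (s * enn2real (wmeasure w E))" .
      then have l: "measure lebesgue E \<le> s * enn2real (wmeasure w E)"
        using s by (simp add: measure_def enn2real_leI)
      then have pos: "0 < s * enn2real (wmeasure w E)" using E by linarith
      then have s0: "0 < s" and w0: "0 < enn2real (wmeasure w E)"
        using s by (auto simp: zero_less_mult_iff)
      have "ennreal (enn2real (wmeasure w Q) / measure lebesgue Q * s) \<le> ennreal K0"
        using le s sq unfolding avg[OF Q] by (subst ennreal_mult) auto
      then have "enn2real (wmeasure w Q) / measure lebesgue Q * s \<le> K0" using K0 by simp
      then have u: "s * enn2real (wmeasure w Q) \<le> K0 * measure lebesgue Q"
        using sq by (simp add: field_simps)
      have "s * (measure lebesgue E * enn2real (wmeasure w Q)) \<le> measure lebesgue E * (K0 * measure lebesgue Q)"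
        using mult_left_mono[OF u, of "measure lebesgue E"] by (simp add: mult_ac)
      also have "\<dots> \<le> (s * enn2real (wmeasure w E)) * (K0 * measure lebesgue Q)"
        using l K0 sq by (intro mult_right_mono) auto
      finally have "s * (measure lebesgue E * enn2real (wmeasure w Q)) \<le>
         s * (K0 * measure lebesgue Q * enn2real (wmeasure w E))" by (simp add: mult_ac)
      then have "measure lebesgue E * enn2real (wmeasure w Q) \<le>
         K0 * measure lebesgue Q * enn2real (wmeasure w E)" using s0 by simp
      also have "\<dots> \<le> (K0 + 1) * (2 * measure lebesgue Q) * enn2real (wmeasure w E)"
        using K0 sq by (intro mult_right_mono mult_mono) auto
      finally have "measure lebesgue E / (2 * measure lebesgue Q) * enn2real (wmeasure w Q)
          \<le> (K0 + 1) * enn2real (wmeasure w E)"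
        using sq by (simp add: field_simps)
      then show "0 < enn2real (wmeasure w E) \<and>
        (measure lebesgue E / (2 * measure lebesgue Q)) powr p * enn2real (wmeasure w Q)
        \<le> (K0 + 1) * enn2real (wmeasure w E)"
        using w0 True E sq by simp
    qed
  next
    case False
    then have p1: "p > 1" using p by simp
    \<comment> \<open>This is p'/p, the exponent of the dual weight.\<close>
    define s where "s = 1 / (p - 1)"
    have s0: "s > 0" using p1 by (simp add: s_def)
    have cp: "conj_exp p / p = s" "p / conj_exp p = p - 1"
      using p1 by (auto simp: conj_exp_def s_def)
    define B where "B Q = average Q (\<lambda>z. inverse (ennreal (w z powr s)))" for Q
    obtain K0 where K0: "(SUP Q\<in>squares. mult_top (average Q (\<lambda>z. ennreal (w z))) (ennpowr (B Q) (p - 1))) = ennreal K0"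
        "0 \<le> K0"
    proof -
      have "(SUP Q\<in>squares. mult_top (average Q (\<lambda>z. ennreal (w z))) (ennpowr (B Q) (p - 1))) < top"
        using w False unfolding Muckenhoupt_def B_def cp by simp
      then show ?thesis using that by (cases rule: ennreal_cases) auto
    qed
    show ?thesis
    proof (rule that[of "K0 + 1"])
      show "0 < K0 + 1" using K0 by simp
      fix Q E assume Q: "Q \<in> squares" and E: "E \<in> sets lebesgue" "E \<subseteq> Q" "0 < measure lebesgue E"
      note sq = squareD[OF Q]
      have bE: "bounded E" using E sq bounded_subset by blast
      have "mult_top (average Q (\<lambda>z. ennreal (w z))) (ennpowr (B Q) (p - 1)) \<le> ennreal K0"
        unfolding K0(1)[symmetric] using Q by (intro SUP_upper)
      then have "ennpowr (B Q) (p - 1) \<noteq> top" 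
        and le: "average Q (\<lambda>z. ennreal (w z)) * ennpowr (B Q) (p - 1) \<le> ennreal K0"
        by (auto simp: mult_top_def top_unique split: if_splits)
      then have Bt: "B Q \<noteq> top" by (auto simp: ennpowr_def)
      define I where "I = (\<integral>\<^sup>+z\<in>Q. inverse (ennreal (w z powr s)) \<partial>lebesgue)"
      have "I \<noteq> top"
        using Bt sq unfolding B_def average_def I_def[symmetric]
        by (auto simp: ennreal_top_divide)
      then obtain S where S: "I = ennreal S" "0 \<le> S" by (cases I) auto
      have BS: "B Q = ennreal (S / measure lebesgue Q)"
        unfolding B_def average_def I_def[symmetric] using S sq by (simp add: divide_ennreal)
      \<comment> \<open>The dual term is enlarged from E to Q, because the Muckenhoupt condition
        controls the dual weight through its average over the whole square.\<close>
      have m: "measure lebesgue E \<le> t * enn2real (wmeasure w E) + t powr (- s) * S" if t: "t > 0" for t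
      proof -
        have "emeasure lebesgue E = (\<integral>\<^sup>+z. indicator E z \<partial>lebesgue)"
          using E by simp
        also have "\<dots> \<le> (\<integral>\<^sup>+z. ennreal t * (ennreal (w z) * indicator E z)
            + ennreal (t powr (- s)) * (inverse (ennreal (w z powr s)) * indicator Q z) \<partial>lebesgue)"
        proof (rule nn_integral_mono)
          fix z
          show "indicator E z \<le> ennreal t * (ennreal (w z) * indicator E z)
            + ennreal (t powr (- s)) * (inverse (ennreal (w z powr s)) * indicator Q z)"
            using one_le_mult_plus_powr[OF nn[of z] t s0] E by (auto split: split_indicator)
        qed
        also have "\<dots> = ennreal t * wmeasure w E + ennreal (t powr (- s)) * I"
          unfolding wmeasure_def I_def using E sq
          by (subst nn_integral_add) (auto simp: nn_integral_cmult)
        also have "\<dots> = ennreal (t * enn2real (wmeasure w E) + t powr (- s) * S)"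
          using t S by (subst fin[OF bE E(1)]) (simp add: ennreal_mult ennreal_plus)
        finally show ?thesis
          using S t by (simp add: measure_def enn2real_leI)
      qed
      define x where "x = measure lebesgue E"
      define y where "y = measure lebesgue Q"
      define e where "e = enn2real (wmeasure w E)"
      define W where "W = enn2real (wmeasure w Q)"
      have xy: "0 < x" "0 < y" "0 \<le> e" "0 \<le> W" using E sq by (auto simp: x_def y_def e_def W_def)
      \<comment> \<open>In \<open>ennreal\<close> the inverse of a finite value is never 0, so a
        vanishing dual integral would make Q a null set.\<close>
      have S0: "S > 0"
      proof (rule ccontr)
        assume "\<not> S > 0"
        then have "S = 0" using S by simp
        then have "I = 0" using S by simp
        then have "AE z in lebesgue. inverse (ennreal (w z powr s)) * indicator Q z = 0"
          unfolding I_def using sq by (subst (asm) nn_integral_0_iff_AE) auto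
        then have "AE z in lebesgue. z \<notin> Q"
          by eventually_elim (auto simp: indicator_def split: if_splits)
        then have "emeasure lebesgue Q = 0"
          using sq by (subst (asm) AE_iff_null_sets[symmetric]) auto
        then show False using sq by simp
      qed
      \<comment> \<open>The value of t is chosen so that the dual term equals x / 2 and can be
        absorbed on the left.\<close>
      have key: "x / 2 \<le> (2 * S / x) powr (p - 1) * e"
      proof -
        define t where "t = (2 * S / x) powr (p - 1)"
        have "t powr (- s) = (2 * S / x) powr (- 1)"
          using p1 by (simp add: t_def powr_powr s_def)
        also have "\<dots> = x / (2 * S)" using S0 xy by (simp add: powr_minus)
        finally have "t powr (- s) * S = x / 2" using S0 by simp
        then have "x \<le> t * e + x / 2"
          using m[of t] S0 xy by (simp add: t_def x_def e_def)
        then show ?thesis by (simp add: t_def)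
      qed
      have "0 < (2 * S / x) powr (p - 1) * e" using key xy by linarith
      then have e0: "0 < e" using xy by (auto simp: zero_less_mult_iff)
      have "ennpowr (B Q) (p - 1) = ennreal ((S / y) powr (p - 1))"
        using S xy unfolding BS ennpowr_def y_def[symmetric] by simp
      then have "ennreal (W / y * (S / y) powr (p - 1)) \<le> ennreal K0"
        using le xy unfolding avg[OF Q] W_def y_def by (subst ennreal_mult) auto
      then have u: "W / y * (S / y) powr (p - 1) \<le> K0" using K0 by simp
      \<comment> \<open>Splitting x / (2 y) as (x / (2 S)) (S / y) isolates the product of averages
        that \<open>K0\<close> bounds; the remaining powers cancel against those in
        \<open>key\<close>.\<close>
      have "(x / (2 * y)) powr p * W = (x / 2) * (x / (2 * S)) powr (p - 1) * (W / y * (S / y) powr (p - 1))"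
      proof -
        have "(x / (2 * y)) powr p = (x / (2 * y)) * (x / (2 * y)) powr (p - 1)"
          using xy by (simp add: powr_diff)
        also have "x / (2 * y) = (x / (2 * S)) * (S / y)" using S0 by simp
        also have "((x / (2 * S)) * (S / y)) powr (p - 1) = (x / (2 * S)) powr (p - 1) * (S / y) powr (p - 1)"
          using xy S0 by (intro powr_mult) 
        finally show ?thesis using S0 by simp
      qed
      also have "\<dots> \<le> (x / 2) * (x / (2 * S)) powr (p - 1) * K0"
        using u xy S0 by (intro mult_left_mono) auto
      also have "\<dots> \<le> ((2 * S / x) powr (p - 1) * e) * (x / (2 * S)) powr (p - 1) * K0"
        using key K0 by (intro mult_right_mono) auto
      also have "\<dots> = K0 * e"
      proof -
        have "(2 * S / x) powr (p - 1) * (x / (2 * S)) powr (p - 1) = ((2 * S / x) * (x / (2 * S))) powr (p - 1)"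
          using xy S0 by (intro powr_mult[symmetric])
        also have "\<dots> = 1" using xy S0 by simp
        finally show ?thesis by (simp add: mult_ac)
      qed
      also have "\<dots> \<le> (K0 + 1) * e" using xy by (intro mult_right_mono) auto
      finally show "0 < enn2real (wmeasure w E) \<and>
        (measure lebesgue E / (2 * measure lebesgue Q)) powr p * enn2real (wmeasure w Q)
        \<le> (K0 + 1) * enn2real (wmeasure w E)"
        using e0 by (simp add: x_def y_def e_def W_def)
    qed
  qed
qed

subsection \<open>Doubling and the weighted mean value inequality\<close>

lemma measure_lebesgue_ball: "0 \<le> r \<Longrightarrow> measure lebesgue (ball (a::complex) r) = pi * r\<^sup>2"
  by (simp add: content_ball unit_ball_vol_2)

text \<open>The comparison is stated for disks, and c and q are the same for all of them. Positivity
  of the measure of disks is a separate assumption, since the comparison would hold trivially on a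
  disk of measure 0.\<close>

locale A_infinity_weight =
  fixes w :: "complex \<Rightarrow> real" and c q :: real
  assumes weight: "weight w" and c_pos: "0 < c" and q_ge_1: "1 \<le> q"
    and wmeasure_ball_pos: "0 < r \<Longrightarrow> 0 < wmeasure w (ball a r)"
    and wmeasure_subset_ball: "0 < r \<Longrightarrow> E \<in> sets lebesgue \<Longrightarrow> E \<subseteq> ball a r \<Longrightarrow>
      c * (measure lebesgue E / r\<^sup>2) powr q * enn2real (wmeasure w (ball a r)) \<le> enn2real (wmeasure w E)"

text \<open>A disk of radius r lies in a concentric square of area 4 r^2. Together with the factor 2
  of \<open>Muckenhoupt_square\<close> this gives the 1 / 8 in the constant, and q is the
  Muckenhoupt exponent p.\<close>

lemma Muckenhoupt_infinity_imp_A_infinity_weight: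
  assumes "w \<in> Muckenhoupt_infinity"
  obtains c q where "A_infinity_weight w c q"
proof -
  obtain p where p: "1 \<le> p" "w \<in> Muckenhoupt p"
    using assms by (auto simp: Muckenhoupt_infinity_def)
  then have wt: "weight w" by (auto simp: Muckenhoupt_def split: if_splits)
  obtain K where K: "0 < K" and *: "\<And>Q E. Q \<in> squares \<Longrightarrow> E \<in> sets lebesgue \<Longrightarrow> E \<subseteq> Q \<Longrightarrow> 0 < measure lebesgue E \<Longrightarrow>
      0 < enn2real (wmeasure w E) \<and>
      (measure lebesgue E / (2 * measure lebesgue Q)) powr p * enn2real (wmeasure w Q)
        \<le> K * enn2real (wmeasure w E)"
    using Muckenhoupt_square[OF p(2,1)] by metis
  define Q where "Q a r = cbox (a - Complex r r) (a - Complex r r + Complex (2 * r) (2 * r))" for a r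
  have Q: "Q a r \<in> squares" "ball a r \<subseteq> Q a r" "measure lebesgue (Q a r) = 4 * r\<^sup>2" if "0 < r" for a r
  proof -
    show "Q a r \<in> squares" using that unfolding squares_def Q_def
      by (auto intro!: exI[of _ "a - Complex r r"] exI[of _ "2 * r"])
    show "ball a r \<subseteq> Q a r"
    proof
      fix z assume "z \<in> ball a r"
      then have "cmod (z - a) < r" by (simp add: dist_norm norm_minus_commute)
      then have "\<bar>Re (z - a)\<bar> < r" "\<bar>Im (z - a)\<bar> < r"
        using abs_Re_le_cmod[of "z - a"] abs_Im_le_cmod[of "z - a"] by linarith+
      then show "z \<in> Q a r" by (auto simp: Q_def in_cbox_complex_iff)
    qed
    show "measure lebesgue (Q a r) = 4 * r\<^sup>2"
      using that by (simp add: Q_def content_cbox_if box_eq_empty Basis_complex_def power2_eq_square)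
  qed
  show ?thesis
  proof (rule that, unfold_locales)
    show "weight w" by fact
    show "0 < (1 / 8) powr p / K" using K by simp
    show "1 \<le> p" by fact
    show "0 < wmeasure w (ball a r)" if "0 < r" for a r
      using *[OF Q(1)[OF that] _ Q(2)[OF that]] that by (auto simp: enn2real_positive_iff)
    show "(1 / 8) powr p / K * (measure lebesgue E / r\<^sup>2) powr p * enn2real (wmeasure w (ball a r))
        \<le> enn2real (wmeasure w E)"
      if r: "0 < r" and E: "E \<in> sets lebesgue" "E \<subseteq> ball a r" for a r E
    proof (cases "measure lebesgue E = 0")
      case False
      then have "0 < measure lebesgue E" by (simp add: zero_less_measure_iff)
      then have "(measure lebesgue E / (2 * measure lebesgue (Q a r))) powr p * enn2real (wmeasure w (Q a r))
          \<le> K * enn2real (wmeasure w E)"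
        using *[OF Q(1)[OF r] E(1)] E(2) Q(2)[OF r] by auto
      moreover have "enn2real (wmeasure w (ball a r)) \<le> enn2real (wmeasure w (Q a r))"
        using Q[OF r] by (intro enn2real_mono wmeasure_mono wmeasure_finite[OF wt]) (auto simp: Q_def)
      ultimately have "(measure lebesgue E / (2 * measure lebesgue (Q a r))) powr p * enn2real (wmeasure w (ball a r))
          \<le> K * enn2real (wmeasure w E)"
        by (meson mult_left_mono order_trans powr_ge_zero)
      moreover have "(measure lebesgue E / (2 * measure lebesgue (Q a r))) powr p
          = (1 / 8) powr p * (measure lebesgue E / r\<^sup>2) powr p"
        unfolding Q(3)[OF r] by (subst powr_mult[symmetric]) auto
      ultimately show ?thesis using K by (simp add: field_simps)
    qed simp
  qed
qed

context A_infinity_weight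
begin

definition M :: "complex measure" where
  "M = density lebesgue (\<lambda>z. ennreal (w z))"

lemma sets_M [simp, measurable_cong]: "sets M = sets lebesgue"
  and space_M [simp]: "space M = UNIV"
  by (simp_all add: M_def)

lemma w_measurable [measurable]: "w \<in> borel_measurable lebesgue"
  and w_nonneg: "0 \<le> w z"
  using weight by (auto simp: weight_def)

lemma emeasure_M: "E \<in> sets lebesgue \<Longrightarrow> emeasure M E = wmeasure w E"
  using weight by (simp add: wmeasure_eq_emeasure M_def)

lemma measure_M: "E \<in> sets lebesgue \<Longrightarrow> measure M E = enn2real (wmeasure w E)"
  by (simp add: measure_def emeasure_M)

lemma emeasure_M_bounded:
  assumes "bounded E" "E \<in> sets lebesgue"
  shows "emeasure M E = ennreal (measure M E)"
  using wmeasure_finite[OF weight assms] assms by (simp add: measure_M emeasure_M)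

lemma measure_M_mono:
  assumes "E \<subseteq> F" "bounded F" "E \<in> sets lebesgue" "F \<in> sets lebesgue"
  shows "measure M E \<le> measure M F"
  using wmeasure_finite[OF weight assms(2,4)] assms wmeasure_mono[OF assms(1)]
  by (simp add: measure_M enn2real_mono)

lemma ball_sets [simp, measurable]: "ball (a::complex) r \<in> sets lebesgue" "cball (a::complex) r \<in> sets lebesgue"
  by auto

lemma measure_M_ball_pos: "0 < r \<Longrightarrow> 0 < measure M (ball a r)"
  using wmeasure_ball_pos[of r a] wmeasure_finite[OF weight, of "ball a r"]
  by (simp add: measure_M enn2real_positive_iff)

lemma measure_M_subset_ball:
  "0 < r \<Longrightarrow> E \<in> sets lebesgue \<Longrightarrow> E \<subseteq> ball a r \<Longrightarrow>
      c * (measure lebesgue E / r\<^sup>2) powr q * measure M (ball a r) \<le> measure M E"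
  using wmeasure_subset_ball by (simp add: measure_M)

text \<open>This is \<open>measure_M_subset_ball\<close> for a smaller disk. The exponent is 2 q
  because areas scale as squares of radii, and the factor \<pi> in the area is bounded below by
  1.\<close>

lemma doubling:
  assumes "0 < \<rho>" "0 < r" "ball b \<rho> \<subseteq> ball a r"
  shows "c * (\<rho> / r) powr (2 * q) * measure M (ball a r) \<le> measure M (ball b \<rho>)"
proof -
  have "(\<rho> / r) powr (2 * q) = ((\<rho> / r)\<^sup>2) powr q"
    using assms by (simp add: powr_powr[symmetric])
  also have "\<dots> \<le> (measure lebesgue (ball b \<rho>) / r\<^sup>2) powr q"
  proof (rule powr_mono2)
    have "\<rho>\<^sup>2 * 1 \<le> \<rho>\<^sup>2 * pi" using pi_ge_two by (intro mult_left_mono) auto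
    then show "(\<rho> / r)\<^sup>2 \<le> measure lebesgue (ball b \<rho>) / r\<^sup>2"
      using assms by (subst measure_lebesgue_ball) (auto simp: power_divide intro!: divide_right_mono simp: mult.commute)
  qed (use q_ge_1 in auto)
  finally have "c * (\<rho> / r) powr (2 * q) * measure M (ball a r)
      \<le> c * (measure lebesgue (ball b \<rho>) / r\<^sup>2) powr q * measure M (ball a r)"
    using c_pos by (intro mult_right_mono mult_left_mono) auto
  also have "\<dots> \<le> measure M (ball b \<rho>)"
    using assms by (intro measure_M_subset_ball) auto
  finally show ?thesis .
qed

text \<open>It makes 1 - c nonnegative, so that the bound of \<open>reverse_doubling\<close> can be
  iterated.\<close>

lemma c_le_1: "c \<le> 1"
proof -
  have "c * 1 powr (2 * q) * measure M (ball 0 1) \<le> measure M (ball 0 1)"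
    using doubling[of 1 1 0 0] by simp
  then show ?thesis using measure_M_ball_pos[of 1 0] by simp
qed

text \<open>The annulus between the two disks has area (3/4) \<pi> r^2, more than r^2, so by the
  comparison it carries at least the fraction c of the measure.\<close>

lemma reverse_doubling:
  assumes "0 < r"
  shows "measure M (ball b (r / 2)) \<le> (1 - c) * measure M (ball b r)"
proof -
  let ?E = "ball b r - ball b (r / 2)"
  have sub: "ball b (r / 2) \<subseteq> ball b r" using assms by auto
  have "measure lebesgue ?E = measure lebesgue (ball b r) - measure lebesgue (ball b (r / 2))"
    using sub by (intro measurable_measure_Diff) auto
  also have "\<dots> = 3 / 4 * pi * r\<^sup>2"
    using assms by (simp add: measure_lebesgue_ball power_divide del: measure_completion)
  finally have E: "measure lebesgue ?E = 3 / 4 * pi * r\<^sup>2" .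
  have "1 \<le> (measure lebesgue ?E / r\<^sup>2) powr q"
    unfolding E using assms q_ge_1 pi_gt3 by (intro ge_one_powr_ge_zero) auto
  then have "c * 1 * measure M (ball b r) \<le> c * (measure lebesgue ?E / r\<^sup>2) powr q * measure M (ball b r)"
    using c_pos by (intro mult_right_mono mult_left_mono) auto
  also have "\<dots> \<le> measure M ?E"
    using assms by (intro measure_M_subset_ball) auto
  also have "\<dots> = measure M (ball b r) - measure M (ball b (r / 2))"
    using sub by (intro measure_Diff) (auto simp: emeasure_M_bounded)
  finally show ?thesis by (simp add: algebra_simps)
qed

text \<open>Halving the radius n times gains the factor (1 - c)^n, uniformly in the centre and the
  radius.\<close>

lemma small_ball:
  assumes "0 < \<epsilon>"
  obtains \<eta> where "0 < \<eta>" "\<eta> \<le> 1" "\<And>b r. 0 < r \<Longrightarrow> measure M (ball b (\<eta> * r)) \<le> \<epsilon> * measure M (ball b r)"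
proof -
  have it: "measure M (ball b (r / 2 ^ n)) \<le> (1 - c) ^ n * measure M (ball b r)" if "0 < r" for b r n
  proof (induction n)
    case (Suc n)
    have "measure M (ball b (r / 2 ^ n / 2)) \<le> (1 - c) * measure M (ball b (r / 2 ^ n))"
      using that by (intro reverse_doubling) auto
    also have "\<dots> \<le> (1 - c) * ((1 - c) ^ n * measure M (ball b r))"
      using Suc c_le_1 by (intro mult_left_mono) auto
    finally show ?case by (simp add: mult_ac)
  qed simp
  obtain n where n: "(1 - c) ^ n < \<epsilon>"
    using real_arch_pow_inv[OF assms, of "1 - c"] c_pos by auto
  show ?thesis
  proof (rule that[of "1 / 2 ^ n"])
    fix b and r :: real assume "0 < r"
    then have "measure M (ball b (r / 2 ^ n)) \<le> (1 - c) ^ n * measure M (ball b r)" by (rule it)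
    also have "\<dots> \<le> \<epsilon> * measure M (ball b r)" using n by (intro mult_right_mono) auto
    finally show "measure M (ball b (1 / 2 ^ n * r)) \<le> \<epsilon> * measure M (ball b r)" by simp
  qed auto
qed

text \<open>
  The maximum of \<open>(r - |z - a|)\<^sup>m |F z|\<close> is attained at some \<open>z0\<close>; near \<open>z0\<close>, on the scale \<open>d\<close> of the
  distance to the boundary, \<open>|F|\<close> is at most \<open>2\<^sup>m |F z0|\<close>, so by Cauchy's inequality it is at least
  \<open>|F z0| / 2\<close> on a disk of comparable radius. The exponent \<open>m\<close> is chosen so that the gain in \<open>|F z0|\<close>
  compensates the loss in the \<open>w\<close>-measure of that disk.
\<close>

lemma weighted_mean_value:
  assumes "0 < p"
  obtains \<kappa> where "0 < \<kappa>"
    "\<And>F a r. F holomorphic_on UNIV \<Longrightarrow> 0 < r \<Longrightarrow>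
      ennreal (\<kappa> * norm (F a) powr p * measure M (ball a r)) \<le> (\<integral>\<^sup>+z\<in>ball a r. ennreal (norm (F z) powr p) \<partial>M)"
proof -
  define m where "m = nat \<lceil>2 * q / p\<rceil>"
  have "2 * q / p \<le> real m" unfolding m_def by linarith
  then have m: "2 * q \<le> real m * p" using assms by (simp add: field_simps)
  \<comment> \<open>Near \<open>z0\<close> Cauchy's inequality bounds the derivative by 2^(m+2) N /
    d, where N = |F z0|. This \<tau> makes the variation of F over a distance \<tau> d at most N /
    2.\<close>
  define \<tau> :: real where "\<tau> = 1 / 2 ^ (m + 3)"
  have \<tau>: "0 < \<tau>" "\<tau> \<le> 1" "\<tau> * 2 ^ (m + 3) = 1" by (auto simp: \<tau>_def)
  define \<kappa> where "\<kappa> = (1 / 2) powr p * c * \<tau> powr (2 * q)"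
  show ?thesis
  proof (rule that[of \<kappa>])
    show "0 < \<kappa>" using c_pos \<tau> by (simp add: \<kappa>_def)
    fix F :: "complex \<Rightarrow> complex" and a and r :: real
    assume F: "F holomorphic_on UNIV" and r: "0 < r"
    have contF: "continuous_on A F" for A
      using F holomorphic_on_imp_continuous_on holomorphic_on_subset by blast
    show "ennreal (\<kappa> * norm (F a) powr p * measure M (ball a r)) \<le> (\<integral>\<^sup>+z\<in>ball a r. ennreal (norm (F z) powr p) \<partial>M)"
    proof (cases "F a = 0")
      case False
      define \<phi> where "\<phi> z = (r - dist a z) ^ m * norm (F z)" for z
      have "continuous_on (cball a r) \<phi>"
        unfolding \<phi>_def by (intro continuous_intros contF)
      then obtain z0 where z0: "z0 \<in> cball a r" and max: "\<And>z. z \<in> cball a r \<Longrightarrow> \<phi> z \<le> \<phi> z0"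
        using continuous_attains_sup[of "cball a r" \<phi>] r by auto
      \<comment> \<open>For m = 0 the factor (r - dist a z)^m would be 1 even on the boundary
        circle, and a positive maximum would not force d > 0.\<close>
      have m0: "m > 0"
        using m q_ge_1 by (cases m) auto
      have "0 < r ^ m * norm (F a)" using False r by simp
      also have le0: "r ^ m * norm (F a) \<le> \<phi> z0" using max[of a] r by (simp add: \<phi>_def)
      finally have "\<phi> z0 > 0" .
      define d where "d = r - dist a z0"
      have d: "0 < d" "d \<le> r" and Fz0: "F z0 \<noteq> 0"
      proof -
        have "\<phi> z0 = d ^ m * norm (F z0)" by (simp add: \<phi>_def d_def)
        then have "d \<noteq> 0" "F z0 \<noteq> 0" using \<open>\<phi> z0 > 0\<close> m0 by (auto simp: power_0_left)
        moreover have "0 \<le> d" "d \<le> r" using z0 by (auto simp: d_def)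
        ultimately show "0 < d" "d \<le> r" "F z0 \<noteq> 0" by auto
      qed
      define N where "N = norm (F z0)"
      have N: "N > 0" using Fz0 by (simp add: N_def)
      have upper: "norm (F z) \<le> 2 ^ m * N" if "z \<in> cball z0 (d / 2)" for z
      proof -
        have dz: "dist a z \<le> dist a z0 + dist z0 z" by (rule dist_triangle)
        then have ge: "r - dist a z \<ge> d / 2" using that by (simp add: d_def field_simps)
        have "(d / 2) ^ m * norm (F z) \<le> \<phi> z"
          unfolding \<phi>_def using ge d by (intro mult_right_mono power_mono) auto
        also have "\<dots> \<le> \<phi> z0" using ge d by (intro max) auto
        also have "\<phi> z0 = d ^ m * N" by (simp add: \<phi>_def d_def N_def)
        finally have "d ^ m * (norm (F z) / 2 ^ m) \<le> d ^ m * N" by (simp add: power_divide)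
        then have "norm (F z) / 2 ^ m \<le> N" using d by (subst (asm) mult_le_cancel_left_pos) auto
        then show ?thesis by (simp add: divide_le_eq mult.commute)
      qed
      have lower: "N / 2 \<le> norm (F z)" if z: "z \<in> ball z0 (\<tau> * d)" for z
      proof -
        \<comment> \<open>The circle of radius d / 4 about x stays in the disk of radius d / 2 about
          \<open>z0\<close>, where \<open>upper\<close> applies.\<close>
        have deriv_bound: "norm (deriv F x) \<le> 2 ^ (m + 2) * N / d" if x: "x \<in> ball z0 (d / 4)" for x
        proof -
          have "norm ((deriv ^^ 1) F x) \<le> fact 1 * (2 ^ m * N) / (d / 4) ^ 1"
          proof (rule Cauchy_inequality)
            show "F holomorphic_on ball x (d / 4)" using F holomorphic_on_subset by blast
            show "0 < d / 4" using d by simp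
            fix y assume "norm (x - y) = d / 4"
            then have "y \<in> cball z0 (d / 2)"
              using x dist_triangle[of z0 y x] by (simp add: dist_norm)
            then show "norm (F y) \<le> 2 ^ m * N" by (rule upper)
          qed (rule contF)
          then show ?thesis by (simp add: field_simps)
        qed
        have "\<tau> * d < d / 4"
        proof -
          have "\<tau> \<le> 1 / 8" unfolding \<tau>_def by (simp add: power_add)
          then have "\<tau> * d \<le> 1 / 8 * d" using d by (intro mult_right_mono) auto
          then show ?thesis using d by simp
        qed
        then have zin: "z \<in> ball z0 (d / 4)" using z by simp
        have "norm (F z - F z0) \<le> 2 ^ (m + 2) * N / d * norm (z - z0)"
        proof (rule field_differentiable_bound[of "ball z0 (d / 4)" F "deriv F"])
          show "(F has_field_derivative deriv F x) (at x within ball z0 (d / 4))" for x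
            using holomorphic_derivI[OF F open_UNIV] has_field_derivative_at_within by blast
        qed (use zin d deriv_bound in auto)
        also have "\<dots> \<le> 2 ^ (m + 2) * N / d * (\<tau> * d)"
          using z N d by (intro mult_left_mono) (auto simp: dist_norm norm_minus_commute)
        also have "\<dots> = N / 2 * (\<tau> * 2 ^ (m + 3))" using d by (simp add: power_add)
        also have "\<dots> = N / 2" using \<tau> by simp
        finally have "norm (F z - F z0) \<le> N / 2" .
        then show ?thesis
          using norm_triangle_ineq2[of "F z0" "F z"] by (simp add: N_def norm_minus_commute)
      qed
      have sub: "ball z0 (\<tau> * d) \<subseteq> ball a r"
      proof
        fix z assume z: "z \<in> ball z0 (\<tau> * d)"
        have "\<tau> * d \<le> d" using \<tau> d by simp
        then show "z \<in> ball a r" using z dist_triangle[of a z z0] by (simp add: d_def)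
      qed
      have "\<kappa> * norm (F a) powr p * measure M (ball a r)
          \<le> (N / 2) powr p * (c * (\<tau> * d / r) powr (2 * q) * measure M (ball a r))"
      proof -
        have "r ^ m * norm (F a) \<le> d ^ m * N" using le0 by (simp add: \<phi>_def d_def N_def)
        then have "norm (F a) \<le> (d / r) ^ m * N" using r by (simp add: field_simps power_divide)
        then have "norm (F a) powr p \<le> ((d / r) ^ m * N) powr p"
          using assms by (intro powr_mono2) auto
        also have "\<dots> = ((d / r) powr real m) powr p * N powr p"
          using d r by (simp add: powr_mult powr_realpow)
        also have "\<dots> = (d / r) powr (real m * p) * N powr p" by (simp add: powr_powr)
        \<comment> \<open>As d \<le> r and 2 q \<le> m p, the power of d / r gained from maximality
          is at least as good as the one lost by \<open>doubling\<close>.\<close>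
        also have "\<dots> \<le> (d / r) powr (2 * q) * N powr p"
          using d r m by (intro mult_right_mono powr_mono') auto
        finally have "\<kappa> * norm (F a) powr p * measure M (ball a r)
            \<le> \<kappa> * ((d / r) powr (2 * q) * N powr p) * measure M (ball a r)"
          using c_pos by (intro mult_right_mono mult_left_mono) (auto simp: \<kappa>_def)
        also have "\<dots> = (N / 2) powr p * (c * (\<tau> * (d / r)) powr (2 * q) * measure M (ball a r))"
          using powr_mult[of "1 / 2" N p] powr_mult[of \<tau> "d / r" "2 * q"]
          by (simp add: \<kappa>_def mult_ac)
        finally show ?thesis by simp
      qed
      also have "\<dots> \<le> (N / 2) powr p * measure M (ball z0 (\<tau> * d))"
        using sub d r \<tau> by (intro mult_left_mono doubling) auto
      finally have "ennreal (\<kappa> * norm (F a) powr p * measure M (ball a r))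
          \<le> ennreal ((N / 2) powr p * measure M (ball z0 (\<tau> * d)))" by (simp add: ennreal_leI)
      also have "\<dots> = (\<integral>\<^sup>+z\<in>ball z0 (\<tau> * d). ennreal ((N / 2) powr p) \<partial>M)"
        by (simp add: nn_integral_cmult_indicator emeasure_M_bounded ennreal_mult)
      also have "\<dots> \<le> (\<integral>\<^sup>+z\<in>ball a r. ennreal (norm (F z) powr p) \<partial>M)"
        using sub lower N assms
        by (intro nn_integral_mono) (auto split: split_indicator intro!: ennreal_leI powr_mono2)
      finally show ?thesis .
    qed (use assms in simp)
  qed
qed

end

subsection \<open>Sets where a holomorphic function is small\<close>

text \<open>A constant function that is nonzero at one point has no zeros; otherwise the zeros are
  isolated and a compact set contains finitely many of them.\<close>

lemma finite_zeros_compact: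
  fixes g :: "complex \<Rightarrow> complex"
  assumes "g holomorphic_on S" "open S" "connected S" "compact K" "K \<subseteq> S" "\<zeta> \<in> K" "g \<zeta> \<noteq> 0"
  shows "finite {z \<in> K. g z = 0}"
proof (cases "g constant_on S")
  case True
  then obtain k where "\<And>x. x \<in> S \<Longrightarrow> g x = k" by (auto simp: constant_on_def)
  then have "g z = g \<zeta>" if "z \<in> K" for z using assms(5,6) that by (metis subsetD)
  then have "{z \<in> K. g z = 0} = {}" using assms(7) by auto
  then show ?thesis by (simp only: finite.emptyI)
next
  case False
  then show ?thesis using holomorphic_compact_finite_zeros[OF assms(1-5)] by blast
qed

context A_infinity_weight
begin

text \<open>
  In a sequence of counterexamples, recentred at the origin, a subsequence converges to a nonzero
  limit. Its finitely many zeros are fixed before the radius of the disks around them is chosen, so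
  no uniform bound on the number of zeros is needed.
\<close>

lemma small_values:
  assumes "0 < R" "0 < \<epsilon>"
  obtains \<eta> where "0 < \<eta>"
    "\<And>F a. F holomorphic_on UNIV \<Longrightarrow> (\<And>z. z \<in> ball a (2 * R) \<Longrightarrow> norm (F z) \<le> L) \<Longrightarrow>
      (\<exists>z\<in>cball a R. 1 \<le> norm (F z)) \<Longrightarrow>
      measure M {z\<in>ball a R. norm (F z) < \<eta>} \<le> \<epsilon> * measure M (ball a R)"
proof (rule ccontr)
  assume contr: "\<not> thesis"
  define P where "P n F a \<longleftrightarrow> F holomorphic_on UNIV \<and> (\<forall>z\<in>ball a (2 * R). norm (F z) \<le> L) \<and>
      (\<exists>z\<in>cball a R. 1 \<le> norm (F z)) \<and>
      \<epsilon> * measure M (ball a R) < measure M {z\<in>ball a R. norm (F z) < 1 / real (Suc n)}"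
    for n :: nat and F :: "complex \<Rightarrow> complex" and a
  have "\<exists>F a. P n F a" for n
  proof (rule ccontr)
    assume none: "\<not> ?thesis"
    have thesis
    proof (rule that[of "1 / real (Suc n)"])
      fix F a
      assume "F holomorphic_on UNIV" "\<And>z. z \<in> ball a (2 * R) \<Longrightarrow> norm (F z) \<le> L"
        "\<exists>z\<in>cball a R. 1 \<le> norm (F z)"
      with none show "measure M {z\<in>ball a R. norm (F z) < 1 / real (Suc n)} \<le> \<epsilon> * measure M (ball a R)"
        unfolding P_def by (meson not_le)
    qed simp
    with contr show False ..
  qed
  then obtain F a where "\<And>n. P n (F n) (a n)" by metis
  then have F: "\<And>n. F n holomorphic_on UNIV"
      and L: "\<And>n z. z \<in> ball (a n) (2 * R) \<Longrightarrow> norm (F n z) \<le> L"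
      and one: "\<And>n. \<exists>z\<in>cball (a n) R. 1 \<le> norm (F n z)"
      and big: "\<And>n. \<epsilon> * measure M (ball (a n) R) < measure M {z\<in>ball (a n) R. norm (F n z) < 1 / real (Suc n)}"
    unfolding P_def by blast+
  \<comment> \<open>The centres may tend to infinity, so the functions are moved to the origin
    before a limit is taken. The measure stays in place, hence all bounds on it have to be uniform
    in the centre.\<close>
  define H where "H n z = F n (a n + z)" for n z
  have H: "H n holomorphic_on UNIV" for n
  proof -
    have "(F n \<circ> (\<lambda>z. a n + z)) holomorphic_on UNIV"
      using F by (intro holomorphic_on_compose_gen[where t=UNIV]) (auto intro!: holomorphic_intros)
    then show ?thesis by (simp add: H_def[abs_def] o_def)
  qed
  have HL: "norm (H n z) \<le> L" if "z \<in> ball 0 (2 * R)" for n z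
    unfolding H_def using that by (intro L) (simp add: dist_norm)
  define S :: "complex set" where "S = ball 0 (2 * R)"
  define K :: "complex set" where "K = cball 0 R"
  have KS: "K \<subseteq> S" "compact K" "open S" "connected S"
    using assms by (auto simp: K_def S_def)
  obtain g s where g: "g holomorphic_on S" and s: "strict_mono (s :: nat \<Rightarrow> nat)"
    and ul: "\<And>K. compact K \<Longrightarrow> K \<subseteq> S \<Longrightarrow> uniform_limit K (H \<circ> s) g sequentially"
  proof (rule Montel[of S "{h. h holomorphic_on S \<and> (\<forall>z\<in>S. norm (h z) \<le> L)}" H])
    show "range H \<subseteq> {h. h holomorphic_on S \<and> (\<forall>z\<in>S. norm (h z) \<le> L)}"
      using H HL holomorphic_on_subset by (fastforce simp: S_def)
  qed (use KS in blast)+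
  have close: "\<forall>\<^sub>F n in sequentially. \<forall>z\<in>K. norm (H (s n) z - g z) < e" if "0 < e" for e
    using uniform_limitD[OF ul[OF KS(2,1)] that] by (simp add: dist_norm)
  \<comment> \<open>The point where |F n| \<ge> 1 depends on n, but a single n for which the
    function is within distance less than 1 of the limit on K suffices.\<close>
  have "\<exists>\<zeta>\<in>K. g \<zeta> \<noteq> 0"
  proof -
    obtain n where n: "\<forall>z\<in>K. norm (H (s n) z - g z) < 1"
      using eventually_happens[OF close[of 1]] by auto
    obtain z where z: "z \<in> cball (a (s n)) R" "1 \<le> norm (F (s n) z)" using one by blast
    have "z - a (s n) \<in> K" using z by (simp add: K_def dist_norm norm_minus_commute)
    then have "norm (F (s n) z - g (z - a (s n))) < 1" using n by (force simp: H_def)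
    then have "g (z - a (s n)) \<noteq> 0" using z by auto
    then show ?thesis using \<open>z - a (s n) \<in> K\<close> by blast
  qed
  define Z where "Z = {z \<in> K. g z = 0}"
  have finZ: "finite Z"
    unfolding Z_def using finite_zeros_compact[OF g KS(3,4,2,1)] \<open>\<exists>\<zeta>\<in>K. g \<zeta> \<noteq> 0\<close> by blast
  define D where "D = c * (1 / 2) powr (2 * q)"
  have D: "0 < D" using c_pos by (simp add: D_def)
  \<comment> \<open>D is the loss in passing from a disk of radius R about b + \<zeta> to the one
    about b, through the disk of radius 2 R about b. The denominator shares \<epsilon> among the
    zeros and stays positive if there are none.\<close>
  define \<epsilon>1 where "\<epsilon>1 = \<epsilon> * D / (real (card Z) + 1)"
  have "0 < \<epsilon>1" using D assms by (simp add: \<epsilon>1_def)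
  then obtain \<eta> where \<eta>: "0 < \<eta>" "\<eta> \<le> 1"
      "\<And>b r. 0 < r \<Longrightarrow> measure M (ball b (\<eta> * r)) \<le> \<epsilon>1 * measure M (ball b r)"
    using small_ball by metis
  have ballZ: "measure M (ball (b + \<zeta>) (\<eta> * R)) \<le> \<epsilon> / (real (card Z) + 1) * measure M (ball b R)"
    if "\<zeta> \<in> Z" for b \<zeta>
  proof -
    have "ball (b + \<zeta>) R \<subseteq> ball b (2 * R)"
    proof
      fix x assume "x \<in> ball (b + \<zeta>) R"
      then show "x \<in> ball b (2 * R)"
        using that dist_triangle[of b x "b + \<zeta>"] by (simp add: Z_def K_def dist_norm)
    qed
    then have "measure M (ball (b + \<zeta>) R) \<le> measure M (ball b (2 * R))"
      by (intro measure_M_mono) auto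
    moreover have "D * measure M (ball b (2 * R)) \<le> measure M (ball b R)"
      using doubling[of R "2 * R" b b] assms subset_ball[of R "2 * R" b] by (simp add: D_def)
    ultimately have "D * measure M (ball (b + \<zeta>) R) \<le> measure M (ball b R)"
      using D by (meson less_eq_real_def mult_left_mono order_trans)
    then have "\<epsilon> / (real (card Z) + 1) * (D * measure M (ball (b + \<zeta>) R))
        \<le> \<epsilon> / (real (card Z) + 1) * measure M (ball b R)"
      using assms by (intro mult_left_mono) auto
    then show ?thesis using \<eta>(3)[OF assms(1), of "b + \<zeta>"] by (simp add: \<epsilon>1_def)
  qed
  \<comment> \<open>Removing open disks about all zeros leaves a compact set on which |g| has a
    positive lower bound m; if the set is empty, any m will do.\<close>
  define K' where "K' = K - (\<Union>\<zeta>\<in>Z. ball \<zeta> (\<eta> * R))"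
  have "compact K'" unfolding K'_def using KS(2) by (intro compact_diff) auto
  obtain m where m: "0 < m" "\<And>z. z \<in> K' \<Longrightarrow> m \<le> norm (g z)"
  proof (cases "K' = {}")
    case False
    have "K' \<subseteq> S" using KS by (auto simp: K'_def)
    then have "continuous_on K' (\<lambda>z. norm (g z))"
      using holomorphic_on_imp_continuous_on[OF g] by (intro continuous_on_norm) (rule continuous_on_subset)
    then obtain x where x: "x \<in> K'" "\<forall>y\<in>K'. norm (g x) \<le> norm (g y)"
      using continuous_attains_inf[OF \<open>compact K'\<close> False] by blast
    have "g x \<noteq> 0"
    proof
      assume "g x = 0"
      then have "x \<in> Z" using x by (auto simp: Z_def K'_def)
      then have "x \<in> (\<Union>\<zeta>\<in>Z. ball \<zeta> (\<eta> * R))" using \<eta> assms by (intro UN_I[of x]) auto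
      then show False using x by (simp add: K'_def)
    qed
    then show ?thesis using x that[of "norm (g x)"] by auto
  qed (use that[of 1] in auto)
  have "(\<lambda>n. 1 / real (Suc (s n))) \<longlonglongrightarrow> 0"
    using LIMSEQ_subseq_LIMSEQ[OF LIMSEQ_inverse_real_of_nat s] by (simp add: o_def inverse_eq_divide)
  then have "\<forall>\<^sub>F n in sequentially. 1 / real (Suc (s n)) < m / 2"
    using m by (intro order_tendstoD) auto
  moreover have "\<forall>\<^sub>F n in sequentially. \<forall>z\<in>K. norm (H (s n) z - g z) < m / 2"
    using m by (intro close) simp
  \<comment> \<open>The two tolerances m / 2 add up to m: where |F (s n)| < 1 / (s n + 1), the limit
    has modulus below m at the recentred point, which therefore lies near a zero.\<close>
  ultimately have "\<forall>\<^sub>F n in sequentially. 1 / real (Suc (s n)) < m / 2 \<and> (\<forall>z\<in>K. norm (H (s n) z - g z) < m / 2)"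
    by eventually_elim auto
  then obtain n where n: "1 / real (Suc (s n)) < m / 2" "\<forall>z\<in>K. norm (H (s n) z - g z) < m / 2"
    using eventually_happens by force
  define b where "b = a (s n)"
  let ?E = "{z\<in>ball b R. norm (F (s n) z) < 1 / real (Suc (s n))}"
  have "continuous_on UNIV (F (s n))" using F holomorphic_on_imp_continuous_on by blast
  then have "open {z. norm (F (s n) z) < 1 / real (Suc (s n))}"
    by (intro open_Collect_less continuous_intros)
  then have "open (ball b R \<inter> {z. norm (F (s n) z) < 1 / real (Suc (s n))})" by blast
  then have "ball b R \<inter> {z. norm (F (s n) z) < 1 / real (Suc (s n))} \<in> sets lebesgue"
    by (intro sets_completionI_sets) simp
  then have Eset: "?E \<in> sets lebesgue" by (simp only: Int_def mem_Collect_eq Collect_mem_eq)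
  have "?E \<subseteq> (\<Union>\<zeta>\<in>Z. ball (b + \<zeta>) (\<eta> * R))"
  proof
    fix z assume z: "z \<in> ?E"
    have zK: "z - b \<in> K" using z by (simp add: K_def dist_norm norm_minus_commute)
    then have "norm (F (s n) z - g (z - b)) < m / 2" using n by (force simp: H_def b_def)
    moreover have "norm (F (s n) z) < m / 2" using z n by simp
    ultimately have "norm (g (z - b)) < m"
      using norm_triangle_ineq4[of "F (s n) z" "F (s n) z - g (z - b)"] by simp
    then have "z - b \<notin> K'" using m(2) by force
    then obtain \<zeta> where "\<zeta> \<in> Z" "z - b \<in> ball \<zeta> (\<eta> * R)" using zK by (auto simp: K'_def)
    then have "z \<in> ball (b + \<zeta>) (\<eta> * R)" by (simp add: dist_norm algebra_simps)
    then show "z \<in> (\<Union>\<zeta>\<in>Z. ball (b + \<zeta>) (\<eta> * R))" using \<open>\<zeta> \<in> Z\<close> by blast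
  qed
  then have "measure M ?E \<le> measure M (\<Union>\<zeta>\<in>Z. ball (b + \<zeta>) (\<eta> * R))"
    using Eset finZ by (intro measure_M_mono) auto
  also have "\<dots> \<le> (\<Sum>\<zeta>\<in>Z. measure M (ball (b + \<zeta>) (\<eta> * R)))"
    using finZ by (intro measure_UNION_le) auto
  also have "\<dots> \<le> (\<Sum>\<zeta>\<in>Z. \<epsilon> / (real (card Z) + 1) * measure M (ball b R))"
    by (intro sum_mono ballZ)
  also have "\<dots> = real (card Z) / (real (card Z) + 1) * (\<epsilon> * measure M (ball b R))" by simp
  also have "\<dots> \<le> 1 * (\<epsilon> * measure M (ball b R))"
    using assms by (intro mult_right_mono) auto
  finally show False using big[of "s n"] by (simp add: b_def)
qed

section \<open>Averaging over the centres of disks\<close>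

sublocale sigma_finite_measure M
proof
  have "x \<in> (\<Union>n. ball 0 (real n))" for x :: complex
    using reals_Archimedean2[of "norm x"] by auto
  then have "(\<Union>n. ball (0::complex) (real n)) = UNIV" by blast
  moreover have "emeasure M (ball 0 (real n)) \<noteq> \<infinity>" for n
    using emeasure_M_bounded[of "ball 0 (real n)"] by simp
  ultimately show "\<exists>A. countable A \<and> A \<subseteq> sets M \<and> \<Union>A = space M \<and> (\<forall>a\<in>A. emeasure M a \<noteq> \<infinity>)"
    by (intro exI[of _ "range (\<lambda>n. ball 0 (real n))"] conjI ballI)
      (simp_all only: space_M, force+)
qed

text \<open>By Fubini's theorem: z lies in the disk about a iff a lies in the disk about z, so each
  z is counted with weight \<pi> R^2. The centres are averaged with respect to Lebesgue measure, not
  M.\<close>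

lemma
  assumes [measurable]: "h \<in> borel_measurable lebesgue"
  shows measurable_ball_average: "(\<lambda>a. \<integral>\<^sup>+z\<in>ball a R. h z \<partial>M) \<in> borel_measurable lborel"
    and nn_integral_ball_average: "0 \<le> R \<Longrightarrow> (\<integral>\<^sup>+a. (\<integral>\<^sup>+z\<in>ball a R. h z \<partial>M) \<partial>lborel) = ennreal (pi * R\<^sup>2) * (\<integral>\<^sup>+z. h z \<partial>M)"
proof -
  have [measurable]: "h \<in> borel_measurable M"
    using assms measurable_cong_sets[OF sets_M refl] by blast
  have [measurable]: "(\<lambda>x. x) \<in> measurable M borel"
    by (auto simp: measurable_def)
  have "(\<lambda>x. h (snd x) * indicator {x. dist (fst x) (snd x) < R} x) \<in> borel_measurable (lborel \<Otimes>\<^sub>M M)"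
    by measurable
  then have m: "(\<lambda>(a, z). h z * indicator (ball a R) z) \<in> borel_measurable (lborel \<Otimes>\<^sub>M M)"
    by (simp add: case_prod_beta' indicator_def)
  then show "(\<lambda>a. \<integral>\<^sup>+z\<in>ball a R. h z \<partial>M) \<in> borel_measurable lborel"
    by (rule borel_measurable_nn_integral)
  interpret pair_sigma_finite lborel M ..
  assume "0 \<le> R"
  have "(\<integral>\<^sup>+a. (\<integral>\<^sup>+z\<in>ball a R. h z \<partial>M) \<partial>lborel) = (\<integral>\<^sup>+z. \<integral>\<^sup>+a. h z * indicator (ball a R) z \<partial>lborel \<partial>M)"
    by (rule Fubini'[OF m, symmetric])
  also have "\<dots> = (\<integral>\<^sup>+z. \<integral>\<^sup>+a. h z * indicator (ball z R) a \<partial>lborel \<partial>M)"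
    by (simp add: indicator_def dist_commute)
  also have "\<dots> = (\<integral>\<^sup>+z. ennreal (pi * R\<^sup>2) * h z \<partial>M)"
    using \<open>0 \<le> R\<close> by (simp add: nn_integral_cmult_indicator emeasure_ball unit_ball_vol_2 mult.commute)
  finally show "(\<integral>\<^sup>+a. (\<integral>\<^sup>+z\<in>ball a R. h z \<partial>M) \<partial>lborel) = ennreal (pi * R\<^sup>2) * (\<integral>\<^sup>+z. h z \<partial>M)"
    by (simp add: nn_integral_cmult)
qed

end

subsection \<open>The local and the global estimate\<close>

text \<open>The weight w is left out of the integrand, since it is carried by the measure M.\<close>

definition fock_density :: "real \<Rightarrow> real \<Rightarrow> (complex \<Rightarrow> complex) \<Rightarrow> complex \<Rightarrow> real" where
  "fock_density p \<alpha> f z = norm (f z) powr p * exp (- (p * \<alpha> / 2) * (norm z)\<^sup>2)"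

lemma fock_density_nonneg: "0 \<le> fock_density p \<alpha> f z"
  by (simp add: fock_density_def)

lemma norm_square_shift:
  "(norm z)\<^sup>2 = (norm (z - a))\<^sup>2 + 2 * Re (cnj a * z) - (norm (a::complex))\<^sup>2"
  unfolding cmod_power2 by (simp add: power2_eq_square algebra_simps)

text \<open>Expanding |z - a|^2 recentres the Gaussian at a at the cost of the modulus of a
  zero-free entire function, which is merged into f. On disks of fixed radius about a the remaining
  Gaussian is bounded above and below independently of a.\<close>

lemma fock_density_shift:
  fixes \<alpha> :: real
  defines "F \<equiv> \<lambda>f a z. f z * exp (of_real \<alpha> * (of_real ((norm a)\<^sup>2 / 2) - cnj a * z))"
  shows "fock_density p \<alpha> f z = norm (F f a z) powr p * exp (- (p * \<alpha> / 2) * (norm (z - a))\<^sup>2)"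
proof -
  have "norm (F f a z) = norm (f z) * exp (\<alpha> * ((norm a)\<^sup>2 / 2 - Re (cnj a * z)))"
    by (simp add: F_def norm_mult)
  then have "norm (F f a z) powr p = norm (f z) powr p * exp (p * (\<alpha> * ((norm a)\<^sup>2 / 2 - Re (cnj a * z))))"
    by (simp add: powr_mult exp_powr_real mult.commute)
  moreover have "exp (p * (\<alpha> * ((norm a)\<^sup>2 / 2 - Re (cnj a * z)))) * exp (- (p * \<alpha> / 2) * (norm (z - a))\<^sup>2)
      = exp (- (p * \<alpha> / 2) * (norm z)\<^sup>2)"
    unfolding mult_exp_exp norm_square_shift[of z a] by (simp add: field_simps)
  ultimately show ?thesis by (simp add: fock_density_def mult.assoc)
qed

lemma fock_density_measurable:
  assumes "f holomorphic_on UNIV"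
  shows "(\<lambda>z. ennreal (fock_density p \<alpha> f z)) \<in> borel_measurable lebesgue"
proof -
  have "continuous_on UNIV f" using assms holomorphic_on_imp_continuous_on by blast
  then have [measurable]: "f \<in> borel_measurable borel" by (rule borel_measurable_continuous_onI)
  have "(\<lambda>z. ennreal (fock_density p \<alpha> f z)) \<in> borel_measurable borel"
    unfolding fock_density_def by measurable
  then show ?thesis by (intro measurable_completion) simp
qed

context A_infinity_weight
begin

lemma fock_integral_eq:
  assumes "f holomorphic_on UNIV" "E \<in> sets lebesgue"
  shows "fock_integral p \<alpha> w E f = (\<integral>\<^sup>+z\<in>E. ennreal (fock_density p \<alpha> f z) \<partial>M)"
proof -
  have [measurable]: "(\<lambda>z. ennreal (fock_density p \<alpha> f z) * indicator E z) \<in> borel_measurable lebesgue"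
    using fock_density_measurable[OF assms(1)] assms(2) by measurable
  have "fock_integral p \<alpha> w E f
      = (\<integral>\<^sup>+z. ennreal (w z) * (ennreal (fock_density p \<alpha> f z) * indicator E z) \<partial>lebesgue)"
    unfolding fock_integral_def using w_nonneg
    by (intro nn_integral_cong) (simp add: fock_density_def ennreal_mult mult_ac)
  also have "\<dots> = (\<integral>\<^sup>+z\<in>E. ennreal (fock_density p \<alpha> f z) \<partial>M)"
    unfolding M_def by (intro nn_integral_density[symmetric]) measurable
  finally show ?thesis .
qed

text \<open>C depends neither on f nor on a, so that the inequality can be integrated over all a. K
  stays free so that the first term on the right can be made small enough to be absorbed
  afterwards.\<close>

lemma local_domination:
  assumes p: "0 < p" and \<alpha>: "0 < \<alpha>" and R: "0 < R" and \<delta>: "0 < \<delta>" and K: "0 < K"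
    and G: "G \<in> sets lebesgue"
    and dense: "\<And>a. \<delta> * measure M (ball a R) \<le> measure M (G \<inter> ball a R)"
  obtains C where "0 < C"
    "\<And>f a. f holomorphic_on UNIV \<Longrightarrow>
      (\<integral>\<^sup>+z\<in>ball a R. ennreal (fock_density p \<alpha> f z) \<partial>M)
        \<le> ennreal (1 / K) * (\<integral>\<^sup>+z\<in>ball a (3 * R). ennreal (fock_density p \<alpha> f z) \<partial>M)
          + ennreal C * (\<integral>\<^sup>+z\<in>ball a R. ennreal (fock_density p \<alpha> f z) * indicator G z \<partial>M)"
proof -
  obtain \<kappa> where \<kappa>: "0 < \<kappa>" and mv: "\<And>F a r. F holomorphic_on UNIV \<Longrightarrow> 0 < r \<Longrightarrow>
      ennreal (\<kappa> * norm (F a) powr p * measure M (ball a r)) \<le> (\<integral>\<^sup>+z\<in>ball a r. ennreal (norm (F z) powr p) \<partial>M)"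
    using weighted_mean_value[OF p] by blast
  define \<beta> where "\<beta> = p * \<alpha> / 2"
  have \<beta>: "0 < \<beta>" using p \<alpha> by (simp add: \<beta>_def)
  \<comment> \<open>1 / e bounds the recentred Gaussian from below on the disk of radius 3
    R.\<close>
  define e where "e = exp (\<beta> * (3 * R)\<^sup>2)"
  have e: "0 < e" by (simp add: e_def)
  define D where "D = c * (1 / 3) powr (2 * q)"
  have D: "0 < D" using c_pos by (simp add: D_def)
  \<comment> \<open>With S the maximum of |F| on the closed disk of radius R about a, B S^p will
    bound |F|^p on the disk of radius 2 R: e compares |F|^p with the density, K comes from the
    failure of the first alternative, \<kappa> from the mean value inequality and D from
    doubling.\<close>
  define B where "B = e * K / (\<kappa> * D)"
  have B: "0 < B" using e K \<kappa> D by (simp add: B_def)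
  have gaussian_lower: "inverse e \<le> exp (- \<beta> * (norm (z - a))\<^sup>2)" if "z \<in> ball a (3 * R)" for z a
  proof -
    have "(norm (z - a))\<^sup>2 \<le> (3 * R)\<^sup>2"
      using that by (intro power_mono) (auto simp: dist_norm norm_minus_commute)
    then show ?thesis using \<beta> by (simp add: e_def exp_minus[symmetric])
  qed
  \<comment> \<open>With \<delta> / 2 the set of small values takes away at most half of the share
    of G.\<close>
  obtain \<eta> where \<eta>: "0 < \<eta>" and sv: "\<And>F a. F holomorphic_on UNIV \<Longrightarrow>
      (\<And>z. z \<in> ball a (2 * R) \<Longrightarrow> norm (F z) \<le> B powr (1 / p)) \<Longrightarrow>
      (\<exists>z\<in>cball a R. 1 \<le> norm (F z)) \<Longrightarrow>
      measure M {z\<in>ball a R. norm (F z) < \<eta>} \<le> \<delta> / 2 * measure M (ball a R)"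
    using small_values[OF R, of "\<delta> / 2" "B powr (1 / p)"] \<delta> by auto
  \<comment> \<open>On the rest of G the density is at least (\<eta> S)^p / e, and that rest has at
    least \<delta> / 2 of the measure of the disk.\<close>
  define C where "C = e / (\<eta> powr p * (\<delta> / 2))"
  have C: "0 < C" using e \<eta> \<delta> by (simp add: C_def)
  show ?thesis
  proof (rule that[OF C])
    fix f :: "complex \<Rightarrow> complex" and a
    assume f: "f holomorphic_on UNIV"
    define u where "u z = ennreal (fock_density p \<alpha> f z)" for z
    define F where "F z = f z * exp (of_real \<alpha> * (of_real ((norm a)\<^sup>2 / 2) - cnj a * z))" for z
    have F: "F holomorphic_on UNIV"
      unfolding F_def by (intro holomorphic_intros f)
    have contF: "continuous_on A F" for A
      using F holomorphic_on_imp_continuous_on holomorphic_on_subset by blast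
    have shift: "fock_density p \<alpha> f z = norm (F z) powr p * exp (- \<beta> * (norm (z - a))\<^sup>2)" for z
      unfolding \<beta>_def F_def by (rule fock_density_shift)
    have upper: "fock_density p \<alpha> f z \<le> norm (F z) powr p" for z
      unfolding shift using \<beta> by (intro mult_left_le) auto
    have lower: "norm (F z) powr p \<le> e * fock_density p \<alpha> f z" if "z \<in> ball a (3 * R)" for z
    proof -
      have "norm (F z) powr p * (e * inverse e) \<le> norm (F z) powr p * (e * exp (- \<beta> * (norm (z - a))\<^sup>2))"
        using gaussian_lower[OF that] e by (intro mult_left_mono) auto
      then show ?thesis unfolding shift using e by (simp add: mult_ac)
    qed
    have um [measurable]: "u \<in> borel_measurable lebesgue"
      unfolding u_def[abs_def] by (rule fock_density_measurable[OF f])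
    have um' [measurable]: "u \<in> borel_measurable M"
      using um measurable_cong_sets[OF sets_M refl] by blast
    define \<Phi> where "\<Phi> r = (\<integral>\<^sup>+z\<in>ball a r. u z \<partial>M)" for r
    define \<Phi>G where "\<Phi>G = (\<integral>\<^sup>+z\<in>ball a R. u z * indicator G z \<partial>M)"
    define W where "W = measure M (ball a R)"
    have W: "0 < W" unfolding W_def by (rule measure_M_ball_pos[OF R])
    obtain z1 where z1: "z1 \<in> cball a R" and max: "\<And>z. z \<in> cball a R \<Longrightarrow> norm (F z) \<le> norm (F z1)"
      using continuous_attains_sup[OF compact_cball _ continuous_on_norm[OF contF], of a R] R by auto
    define S where "S = norm (F z1)"
    have "\<Phi> R \<le> (\<integral>\<^sup>+z\<in>ball a R. ennreal (S powr p) \<partial>M)"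
      unfolding \<Phi>_def u_def
    proof (intro nn_integral_mono)
      fix z
      show "ennreal (fock_density p \<alpha> f z) * indicator (ball a R) z \<le> ennreal (S powr p) * indicator (ball a R) z"
      proof (cases "z \<in> ball a R")
        case True
        then have "norm (F z) powr p \<le> S powr p"
          using max[of z] p by (intro powr_mono2) (auto simp: S_def)
        with upper[of z] True show ?thesis by (simp add: ennreal_leI)
      qed simp
    qed
    also have "\<dots> = ennreal (S powr p * W)"
      by (simp add: nn_integral_cmult_indicator emeasure_M_bounded ennreal_mult W_def)
    finally have \<Phi>_le: "\<Phi> R \<le> ennreal (S powr p * W)" .
    have "\<Phi> R \<le> ennreal (1 / K) * \<Phi> (3 * R) + ennreal C * \<Phi>G"
    \<comment> \<open>If S = 0, the integral over the small disk vanishes. In the remaining case the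
      integral over the large disk is at most K S^p W, which limits the growth of F.\<close>
    proof (cases "S = 0 \<or> \<Phi> R \<le> ennreal (1 / K) * \<Phi> (3 * R)")
      case True
      then show ?thesis using \<Phi>_le by (auto simp: add_increasing2)
    next
      case False
      then have S: "0 < S" and less: "ennreal (1 / K) * \<Phi> (3 * R) < \<Phi> R"
        by (auto simp: S_def not_le)
      have "\<Phi> (3 * R) = ennreal K * (ennreal (1 / K) * \<Phi> (3 * R))"
        using K by (simp add: mult.assoc[symmetric] ennreal_mult[symmetric])
      also have "\<dots> \<le> ennreal K * ennreal (S powr p * W)"
        using less \<Phi>_le by (intro mult_left_mono) auto
      also have "\<dots> = ennreal (K * S powr p * W)"
        using K W by (simp add: ennreal_mult[symmetric] mult.assoc)
      finally have \<Phi>3: "\<Phi> (3 * R) \<le> ennreal (K * S powr p * W)" .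
      have bound: "norm (F z) \<le> B powr (1 / p) * S" if z: "z \<in> ball a (2 * R)" for z
      proof -
        have sub: "ball z R \<subseteq> ball a (3 * R)"
        proof
          fix x assume "x \<in> ball z R"
          then show "x \<in> ball a (3 * R)" using z dist_triangle[of a x z] by simp
        qed
        have "ball a R \<subseteq> ball z (3 * R)"
        proof
          fix x assume "x \<in> ball a R"
          then show "x \<in> ball z (3 * R)" using z dist_triangle[of z x a] by (simp add: dist_commute)
        qed
        then have "W \<le> measure M (ball z (3 * R))"
          unfolding W_def by (intro measure_M_mono) auto
        then have "D * W \<le> D * measure M (ball z (3 * R))" using D by (intro mult_left_mono) auto
        also have "\<dots> \<le> measure M (ball z R)"
          using doubling[of R "3 * R" z z] R subset_ball[of R "3 * R" z] by (simp add: D_def)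
        finally have DW: "D * W \<le> measure M (ball z R)" .
        have "ennreal (\<kappa> * norm (F z) powr p * (D * W)) \<le> ennreal (\<kappa> * norm (F z) powr p * measure M (ball z R))"
          using DW \<kappa> by (intro ennreal_leI mult_left_mono) auto
        also have "\<dots> \<le> (\<integral>\<^sup>+x\<in>ball z R. ennreal (norm (F x) powr p) \<partial>M)"
          by (rule mv[OF F R])
        also have "\<dots> \<le> (\<integral>\<^sup>+x. ennreal e * (u x * indicator (ball a (3 * R)) x) \<partial>M)"
        proof (intro nn_integral_mono)
          fix x
          show "ennreal (norm (F x) powr p) * indicator (ball z R) x \<le> ennreal e * (u x * indicator (ball a (3 * R)) x)"
          proof (cases "x \<in> ball z R")
            case True
            then have "x \<in> ball a (3 * R)" using sub by blast
            with lower[OF this] True show ?thesis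
              using e by (simp add: u_def ennreal_mult[symmetric] fock_density_nonneg)
          qed simp
        qed
        also have "\<dots> = ennreal e * \<Phi> (3 * R)"
          unfolding \<Phi>_def by (intro nn_integral_cmult) measurable
        also have "\<dots> \<le> ennreal e * ennreal (K * S powr p * W)"
          using \<Phi>3 by (intro mult_left_mono) auto
        also have "\<dots> = ennreal (e * (K * S powr p * W))"
          using e K W by (simp add: ennreal_mult)
        finally have "\<kappa> * norm (F z) powr p * (D * W) \<le> e * (K * S powr p * W)"
          using e K W by (subst (asm) ennreal_le_iff) auto
        then have "norm (F z) powr p * (\<kappa> * D * W) \<le> (B * S powr p) * (\<kappa> * D * W)"
          using \<kappa> D by (simp add: B_def field_simps)
        then have "norm (F z) powr p \<le> B * S powr p"
          using \<kappa> D W by (subst (asm) mult_le_cancel_right_pos) auto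
        then have "(norm (F z) powr p) powr (1 / p) \<le> (B * S powr p) powr (1 / p)"
          using p by (intro powr_mono2) auto
        then show ?thesis using p S by (simp add: powr_powr powr_mult)
      qed
      \<comment> \<open>After division by S the function has modulus 1 at \<open>z1\<close>, as
        \<open>small_values\<close> demands.\<close>
      define H where "H z = F z / of_real S" for z
      have nH: "norm (H z) = norm (F z) / S" for z using S by (simp add: H_def norm_divide)
      define E where "E = {z\<in>ball a R. norm (H z) < \<eta>}"
      have sE: "measure M E \<le> \<delta> / 2 * W"
        unfolding E_def W_def
      proof (rule sv)
        show "H holomorphic_on UNIV" unfolding H_def using S by (intro holomorphic_intros F) auto
        show "norm (H z) \<le> B powr (1 / p)" if "z \<in> ball a (2 * R)" for z
          using bound[OF that] S by (simp add: nH field_simps)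
        show "\<exists>z\<in>cball a R. 1 \<le> norm (H z)"
          using z1 S by (intro bexI[of _ z1]) (auto simp: nH S_def)
      qed
      have Eset: "E \<in> sets lebesgue"
      proof -
        have "open {z. norm (F z) / S < \<eta>}"
          using S by (intro open_Collect_less continuous_intros contF) auto
        then have "ball a R \<inter> {z. norm (F z) / S < \<eta>} \<in> sets lebesgue"
          by (intro sets_completionI_sets) (simp add: open_Int)
        then show ?thesis unfolding E_def nH by (simp only: Int_def mem_Collect_eq Collect_mem_eq)
      qed
      define A where "A = G \<inter> ball a R - E"
      have Aset: "A \<in> sets lebesgue" using G Eset by (auto simp: A_def)
      have bdd: "bounded (A \<union> E)" "bounded A"
        by (rule bounded_subset[OF bounded_ball[of a R]]; auto simp: A_def E_def)+
      have "\<delta> * W \<le> measure M (G \<inter> ball a R)" unfolding W_def by (rule dense)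
      also have "\<dots> \<le> measure M (A \<union> E)"
        using G Aset Eset bdd by (intro measure_M_mono) (auto simp: A_def)
      also have "\<dots> \<le> measure M A + measure M E"
        using Aset Eset by (intro measure_Un_le) auto
      finally have WA: "\<delta> / 2 * W \<le> measure M A" using sE by simp
      have "ennreal (S powr p * W) = ennreal C * ennreal (inverse e * (\<eta> * S) powr p * (\<delta> / 2 * W))"
        using C e \<eta> S \<delta> W by (simp add: C_def ennreal_mult[symmetric] powr_mult field_simps)
      also have "\<dots> \<le> ennreal C * ennreal (inverse e * (\<eta> * S) powr p * measure M A)"
        using WA e by (intro mult_left_mono ennreal_leI) auto
      also have "ennreal (inverse e * (\<eta> * S) powr p * measure M A)
          = (\<integral>\<^sup>+z\<in>A. ennreal (inverse e * (\<eta> * S) powr p) \<partial>M)"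
        using e Aset bdd by (simp add: nn_integral_cmult_indicator emeasure_M_bounded ennreal_mult)
      also have "\<dots> \<le> \<Phi>G"
        unfolding \<Phi>G_def
      proof (intro nn_integral_mono)
        fix z
        show "ennreal (inverse e * (\<eta> * S) powr p) * indicator A z \<le> u z * indicator G z * indicator (ball a R) z"
        proof (cases "z \<in> A")
          case True
          then have z: "z \<in> G" "z \<in> ball a R" "\<eta> \<le> norm (F z) / S" by (auto simp: A_def E_def nH)
          then have "\<eta> * S \<le> norm (F z)" using S by (simp add: field_simps)
          then have "(\<eta> * S) powr p \<le> norm (F z) powr p" using \<eta> S p by (intro powr_mono2) auto
          then have "inverse e * (\<eta> * S) powr p \<le> inverse e * norm (F z) powr p" using e by simp
          also have "\<dots> \<le> fock_density p \<alpha> f z"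
            using lower[of z] z e R by (simp add: field_simps)
          finally show ?thesis using True z by (simp add: u_def ennreal_leI)
        qed simp
      qed
      finally have "ennreal (S powr p * W) \<le> ennreal C * \<Phi>G" by (simp add: mult_left_mono)
      then show ?thesis using \<Phi>_le by (simp add: add_increasing)
    qed
    then show "(\<integral>\<^sup>+z\<in>ball a R. ennreal (fock_density p \<alpha> f z) \<partial>M)
        \<le> ennreal (1 / K) * (\<integral>\<^sup>+z\<in>ball a (3 * R). ennreal (fock_density p \<alpha> f z) \<partial>M)
          + ennreal C * (\<integral>\<^sup>+z\<in>ball a R. ennreal (fock_density p \<alpha> f z) * indicator G z \<partial>M)"
      by (simp add: \<Phi>_def \<Phi>G_def u_def)
  qed
qed

text \<open>With x and y the integrals over the plane and over G, integrating the local inequality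
  over all centres gives x \<le> x / 2 + C y. Since f lies in the Fock space, x is finite and x / 2
  can be subtracted.\<close>

lemma dominating_if_dense:
  assumes p: "0 < p" and \<alpha>: "0 < \<alpha>" and R: "0 < R" and \<delta>: "0 < \<delta>"
    and G: "G \<in> sets lebesgue"
    and dense: "\<And>a. \<delta> * measure M (ball a R) \<le> measure M (G \<inter> ball a R)"
  shows "dominating_set p \<alpha> w G"
proof -
  \<comment> \<open>\<open>18 = 2 * 9\<close>, as disks of radius \<open>3 R\<close> have \<open>9\<close> times the area: half of the integral is absorbed.\<close>
  obtain C where C: "0 < C" and loc: "\<And>f a. f holomorphic_on UNIV \<Longrightarrow>
      (\<integral>\<^sup>+z\<in>ball a R. ennreal (fock_density p \<alpha> f z) \<partial>M)
        \<le> ennreal (1 / 18) * (\<integral>\<^sup>+z\<in>ball a (3 * R). ennreal (fock_density p \<alpha> f z) \<partial>M)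
          + ennreal C * (\<integral>\<^sup>+z\<in>ball a R. ennreal (fock_density p \<alpha> f z) * indicator G z \<partial>M)"
    using local_domination[OF p \<alpha> R \<delta>, of 18 G] G dense by auto
  have "fock_integral p \<alpha> w UNIV f \<le> ennreal (2 * C) * fock_integral p \<alpha> w G f"
    if f: "f \<in> fock_space p \<alpha> w" for f
  proof -
    have hol: "f holomorphic_on UNIV" and fin: "fock_integral p \<alpha> w UNIV f < top"
      using f by (auto simp: fock_space_def)
    define u where "u z = ennreal (fock_density p \<alpha> f z)" for z
    have um [measurable]: "u \<in> borel_measurable lebesgue"
      unfolding u_def[abs_def] by (rule fock_density_measurable[OF hol])
    have um' [measurable]: "(\<lambda>z. u z * indicator G z) \<in> borel_measurable lebesgue"
      using G by measurable
    have I: "fock_integral p \<alpha> w UNIV f = (\<integral>\<^sup>+z. u z \<partial>M)"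
      using fock_integral_eq[OF hol, of UNIV p \<alpha>] by (simp add: u_def)
    have IG: "fock_integral p \<alpha> w G f = (\<integral>\<^sup>+z. u z * indicator G z \<partial>M)"
      using fock_integral_eq[OF hol G, of p \<alpha>] by (simp add: u_def)
    obtain x where x: "(\<integral>\<^sup>+z. u z \<partial>M) = ennreal x" "0 \<le> x"
      using fin I by (cases "\<integral>\<^sup>+z. u z \<partial>M") auto
    obtain y where y: "(\<integral>\<^sup>+z. u z * indicator G z \<partial>M) = ennreal y" "0 \<le> y"
    proof -
      have "(\<integral>\<^sup>+z. u z * indicator G z \<partial>M) \<le> (\<integral>\<^sup>+z. u z \<partial>M)"
        by (intro nn_integral_mono) (auto split: split_indicator)
      then show ?thesis using that x by (cases "\<integral>\<^sup>+z. u z * indicator G z \<partial>M") (auto simp: top_unique)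
    qed
    have meas: "(\<lambda>a. \<integral>\<^sup>+z\<in>ball a r. h z \<partial>M) \<in> borel_measurable lborel"
      if "h \<in> borel_measurable lebesgue" for h :: "complex \<Rightarrow> ennreal" and r
      by (rule measurable_ball_average[OF that])
    have combine: "ennreal k * (ennreal l * ennreal x) + ennreal C * (ennreal m * ennreal y)
        = ennreal (k * (l * x) + C * (m * y))" if "0 \<le> k" "0 \<le> l" "0 \<le> m" for k l m
      using that x y C by (simp add: ennreal_mult ennreal_plus)
    have "ennreal (pi * R\<^sup>2) * ennreal x = (\<integral>\<^sup>+a. (\<integral>\<^sup>+z\<in>ball a R. u z \<partial>M) \<partial>lborel)"
      using nn_integral_ball_average[OF um, of R] R x by simp
    also have "\<dots> \<le> (\<integral>\<^sup>+a. ennreal (1 / 18) * (\<integral>\<^sup>+z\<in>ball a (3 * R). u z \<partial>M)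
          + ennreal C * (\<integral>\<^sup>+z\<in>ball a R. u z * indicator G z \<partial>M) \<partial>lborel)"
      unfolding u_def by (intro nn_integral_mono loc hol)
    also have "\<dots> = ennreal (1 / 18) * (\<integral>\<^sup>+a. (\<integral>\<^sup>+z\<in>ball a (3 * R). u z \<partial>M) \<partial>lborel)
          + ennreal C * (\<integral>\<^sup>+a. (\<integral>\<^sup>+z\<in>ball a R. u z * indicator G z \<partial>M) \<partial>lborel)"
      using meas[OF um, of "3 * R"] meas[OF um', of R] by (simp add: nn_integral_add nn_integral_cmult)
    also have "\<dots> = ennreal (1 / 18) * (ennreal (pi * (3 * R)\<^sup>2) * ennreal x)
          + ennreal C * (ennreal (pi * R\<^sup>2) * ennreal y)"
      using nn_integral_ball_average[OF um, of "3 * R"] nn_integral_ball_average[OF um', of R] R x y by simp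
    also have "\<dots> = ennreal (1 / 18 * (pi * (3 * R)\<^sup>2 * x) + C * (pi * R\<^sup>2 * y))"
      by (intro combine) auto
    finally have "ennreal (pi * R\<^sup>2 * x) \<le> ennreal (1 / 18 * (pi * (3 * R)\<^sup>2 * x) + C * (pi * R\<^sup>2 * y))"
      using x by (simp add: ennreal_mult)
    then have "pi * R\<^sup>2 * x \<le> 1 / 18 * (pi * (3 * R)\<^sup>2 * x) + C * (pi * R\<^sup>2 * y)"
      using x y C by (subst (asm) ennreal_le_iff) auto
    then have "pi * R\<^sup>2 * x \<le> pi * R\<^sup>2 * (2 * C * y)" by (simp add: power2_eq_square algebra_simps)
    then have "x \<le> 2 * C * y" using R by (subst (asm) mult_le_cancel_left_pos) auto
    then have "ennreal x \<le> ennreal (2 * C) * ennreal y"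
      using y C by (simp add: ennreal_mult[symmetric] ennreal_leI)
    then show ?thesis using I IG x y by simp
  qed
  then show ?thesis
    unfolding dominating_set_def using G C by (intro conjI exI[of _ "2 * C"]) auto
qed

subsection \<open>Testing with reproducing kernels\<close>

text \<open>The complement of the disk is cut into annuli of width 1. By \<open>doubling\<close> the
  measure of the disk of radius n + 1 grows at most polynomially relative to the unit disk, so the
  Gaussian makes the sum converge, with terms independent of a. The disk of radius N = 0 is empty,
  so this case bounds the full integral.\<close>

lemma gaussian_tail_bound:
  assumes \<beta>: "0 < \<beta>"
  obtains b :: "nat \<Rightarrow> real" where "summable b" "\<And>n. 0 \<le> b n"
    "\<And>a N. (\<integral>\<^sup>+z\<in>- ball a (real N). ennreal (exp (- \<beta> * (norm (z - a))\<^sup>2)) \<partial>M)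
        \<le> ennreal ((\<Sum>n. b (n + N)) * measure M (ball a 1))"
proof -
  define b where "b n = exp (- \<beta> * (real n)\<^sup>2) * ((real n + 1) powr (2 * q) / c)" for n
  have b0: "0 \<le> b n" for n using c_pos by (simp add: b_def)
  have "b \<in> O(\<lambda>n. 1 / real n ^ 2)"
    unfolding b_def using \<beta> c_pos q_ge_1 by real_asymp
  moreover have "summable (\<lambda>n. norm (1 / real n ^ 2))"
    using inverse_power_summable[of 2, where 'a=real] by (simp add: inverse_eq_divide)
  ultimately have sb: "summable b"
    by (rule summable_comparison_test_bigo[rotated])
  show ?thesis
  proof (rule that[of b])
    fix a :: complex and N :: nat
    let ?W = "measure M (ball a 1)"
    have growth: "exp (- \<beta> * (real n)\<^sup>2) * measure M (ball a (real n + 1)) \<le> b n * ?W" for n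
    proof -
      have "c * (1 / (real n + 1)) powr (2 * q) * measure M (ball a (real n + 1)) \<le> ?W"
        by (intro doubling subset_ball) auto
      then have "measure M (ball a (real n + 1)) \<le> (real n + 1) powr (2 * q) / c * ?W"
        using c_pos by (simp add: powr_divide field_simps)
      then have "exp (- \<beta> * (real n)\<^sup>2) * measure M (ball a (real n + 1))
          \<le> exp (- \<beta> * (real n)\<^sup>2) * ((real n + 1) powr (2 * q) / c * ?W)"
        by (intro mult_left_mono) auto
      then show ?thesis by (simp add: b_def mult_ac)
    qed
    \<comment> \<open>Each annulus is enlarged to a full disk; at a given z the single term with n +
      N equal to the integer part of |z - a| is large enough.\<close>
    have pointwise: "ennreal (exp (- \<beta> * (norm (z - a))\<^sup>2)) * indicator (- ball a (real N)) z
        \<le> (\<Sum>n. ennreal (exp (- \<beta> * (real (n + N))\<^sup>2)) * indicator (ball a (real (n + N) + 1)) z)"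
      (is "_ \<le> (\<Sum>n. ?t n)") for z
    proof (cases "z \<in> ball a (real N)")
      case False
      define k where "k = nat \<lfloor>norm (z - a)\<rfloor>"
      have k: "real k \<le> norm (z - a)" "norm (z - a) < real k + 1"
        unfolding k_def by (simp_all add: of_nat_nat)
      have N: "real N \<le> norm (z - a)" using False by (simp add: dist_norm norm_minus_commute)
      then have "N \<le> k" unfolding k_def by (simp add: le_nat_floor)
      define n where "n = k - N"
      have nk: "n + N = k" using \<open>N \<le> k\<close> by (simp add: n_def)
      have "(real k)\<^sup>2 \<le> (norm (z - a))\<^sup>2" using k by (intro power_mono) auto
      then have "ennreal (exp (- \<beta> * (norm (z - a))\<^sup>2)) \<le> ennreal (exp (- \<beta> * (real k)\<^sup>2))"
        using \<beta> by (intro ennreal_leI) simp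
      also have "\<dots> = ?t n"
        unfolding nk using k by (simp add: dist_norm norm_minus_commute)
      also have "\<dots> = sum ?t {n}" by (simp only: sum.insert finite.emptyI empty_iff not_False_eq_True sum.empty add_0_right)
      also have "\<dots> \<le> (\<Sum>n. ?t n)"
        by (rule sum_le_suminf) auto
      finally show ?thesis using False by simp
    qed simp
    have "(\<integral>\<^sup>+z\<in>- ball a (real N). ennreal (exp (- \<beta> * (norm (z - a))\<^sup>2)) \<partial>M)
        \<le> (\<integral>\<^sup>+z. (\<Sum>n. ennreal (exp (- \<beta> * (real (n + N))\<^sup>2)) * indicator (ball a (real (n + N) + 1)) z) \<partial>M)"
      by (intro nn_integral_mono pointwise)
    also have "\<dots> = (\<Sum>n. \<integral>\<^sup>+z. ennreal (exp (- \<beta> * (real (n + N))\<^sup>2)) * indicator (ball a (real (n + N) + 1)) z \<partial>M)"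
      by (intro nn_integral_suminf) measurable
    also have "\<dots> = (\<Sum>n. ennreal (exp (- \<beta> * (real (n + N))\<^sup>2) * measure M (ball a (real (n + N) + 1))))"
      by (intro suminf_cong) (simp add: nn_integral_cmult_indicator emeasure_M_bounded ennreal_mult)
    also have "\<dots> \<le> (\<Sum>n. ennreal (b (n + N) * ?W))"
      by (intro suminf_le summableI ennreal_leI growth)
    also have "\<dots> = ennreal (\<Sum>n. b (n + N) * ?W)"
      using sb b0 by (intro suminf_ennreal2) (auto simp: summable_iff_shift intro!: summable_mult2)
    also have "(\<Sum>n. b (n + N) * ?W) = (\<Sum>n. b (n + N)) * ?W"
      using sb by (intro suminf_mult2[symmetric]) (simp add: summable_iff_shift)
    finally show "(\<integral>\<^sup>+z\<in>- ball a (real N). ennreal (exp (- \<beta> * (norm (z - a))\<^sup>2)) \<partial>M)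
        \<le> ennreal ((\<Sum>n. b (n + N)) * ?W)" .
  qed (use sb b0 in auto)
qed

text \<open>The Gaussian about a has integral at least \<theta> times the measure of the unit disk
  about a, while its part outside a large disk contributes at most half of that to the dominating
  inequality. G must supply the rest inside the large disk.\<close>

lemma dense_if_dominating:
  assumes p: "0 < p" and \<alpha>: "0 < \<alpha>" and dom: "dominating_set p \<alpha> w G"
  obtains R \<delta> where "0 < R" "0 < \<delta>" "\<And>a. \<delta> * measure M (ball a R) \<le> measure M (G \<inter> ball a R)"
proof -
  have G: "G \<in> sets lebesgue" using dom by (simp add: dominating_set_def)
  obtain C where C: "0 < C" and domC: "\<And>f. f \<in> fock_space p \<alpha> w \<Longrightarrow>
      fock_integral p \<alpha> w UNIV f \<le> ennreal C * fock_integral p \<alpha> w G f"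
    using dom unfolding dominating_set_def by auto
  define \<beta> where "\<beta> = p * \<alpha> / 2"
  have \<beta>: "0 < \<beta>" using p \<alpha> by (simp add: \<beta>_def)
  obtain b :: "nat \<Rightarrow> real" where sb: "summable b" and b0: "\<And>n. 0 \<le> b n" and tail:
    "\<And>a N. (\<integral>\<^sup>+z\<in>- ball a (real N). ennreal (exp (- \<beta> * (norm (z - a))\<^sup>2)) \<partial>M)
        \<le> ennreal ((\<Sum>n. b (n + N)) * measure M (ball a 1))"
    by (rule gaussian_tail_bound[OF \<beta>]) (rule that)
  define \<theta> where "\<theta> = exp (- \<beta>)"
  have \<theta>: "0 < \<theta>" by (simp add: \<theta>_def)
  have "(\<lambda>N. \<Sum>n. b (n + N)) \<longlonglongrightarrow> 0" by (rule suminf_exist_split2[OF sb])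
  then have "\<forall>\<^sub>F N in sequentially. (\<Sum>n. b (n + N)) < \<theta> / (2 * C)"
    using \<theta> C by (intro order_tendstoD) auto
  \<comment> \<open>The bound \<theta> / (2 C) leaves half of the lower bound after multiplication
    by C; 1 \<le> N puts the unit disk inside the disk of radius R.\<close>
  then have "\<forall>\<^sub>F N in sequentially. (\<Sum>n. b (n + N)) < \<theta> / (2 * C) \<and> 1 \<le> N"
    using eventually_ge_at_top[of 1] by eventually_elim auto
  then obtain N where N: "(\<Sum>n. b (n + N)) < \<theta> / (2 * C)" "1 \<le> N"
    using eventually_happens by force
  define R where "R = real N"
  have R: "1 \<le> R" using N by (simp add: R_def)
  define \<epsilon> where "\<epsilon> = (\<Sum>n. b (n + N))"
  have \<epsilon>: "0 \<le> \<epsilon>" "C * \<epsilon> \<le> \<theta> / 2"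
    using N C sb b0 by (auto simp: \<epsilon>_def field_simps summable_iff_shift intro!: suminf_nonneg)
  define D where "D = c * (1 / R) powr (2 * q)"
  have D: "0 < D" using c_pos R by (simp add: D_def)
  define \<delta> where "\<delta> = \<theta> / (2 * C) * D"
  show ?thesis
  proof (rule that[of R \<delta>])
    show "0 < R" using R by simp
    show "0 < \<delta>" using \<theta> C D by (simp add: \<delta>_def)
    fix a
    \<comment> \<open>This cancels the exponential factor in \<open>fock_density_shift\<close>. It
      equals exp (\<alpha> (cnj a * z) - \<alpha> |a|^2 / 2), the normalized reproducing kernel at a
      of the unweighted Fock space with exponent 2.\<close>
    define f where "f z = inverse (exp (of_real \<alpha> * (of_real ((norm a)\<^sup>2 / 2) - cnj a * z)))" for z
    have hol: "f holomorphic_on UNIV"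
      unfolding f_def by (intro holomorphic_intros) auto
    have dens: "fock_density p \<alpha> f z = exp (- \<beta> * (norm (z - a))\<^sup>2)" for z
      unfolding fock_density_shift[of p \<alpha> f z a] by (simp add: f_def \<beta>_def)
    define g where "g z = ennreal (exp (- \<beta> * (norm (z - a))\<^sup>2))" for z
    have gm: "g \<in> borel_measurable lebesgue"
      using fock_density_measurable[OF hol, of p \<alpha>] by (simp add: dens g_def[abs_def])
    then have gm' [measurable]: "g \<in> borel_measurable M"
      using measurable_cong_sets[OF sets_M refl] by blast
    have fi: "fock_integral p \<alpha> w E f = (\<integral>\<^sup>+z\<in>E. g z \<partial>M)" if "E \<in> sets lebesgue" for E
      using fock_integral_eq[OF hol that, of p \<alpha>] by (simp add: dens g_def)
    define W where "W = measure M (ball a 1)"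
    have "f \<in> fock_space p \<alpha> w"
    proof -
      have "fock_integral p \<alpha> w UNIV f \<le> ennreal ((\<Sum>n. b (n + 0)) * measure M (ball a 1))"
        using tail[of a 0] fi[of UNIV] by (simp add: g_def)
      also have "\<dots> < top" by simp
      finally show ?thesis using hol by (simp add: fock_space_def)
    qed
    then have dG: "(\<integral>\<^sup>+z. g z \<partial>M) \<le> ennreal C * (\<integral>\<^sup>+z\<in>G. g z \<partial>M)"
      using domC[of f] fi[of UNIV] fi[OF G] by simp
    have "ennreal (\<theta> * W) = (\<integral>\<^sup>+z\<in>ball a 1. ennreal \<theta> \<partial>M)"
      using \<theta> by (simp add: nn_integral_cmult_indicator emeasure_M_bounded ennreal_mult W_def)
    also have "\<dots> \<le> (\<integral>\<^sup>+z. g z \<partial>M)"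
    proof (intro nn_integral_mono)
      fix z
      show "ennreal \<theta> * indicator (ball a 1) z \<le> g z"
      proof (cases "z \<in> ball a 1")
        case True
        then have "(norm (z - a))\<^sup>2 \<le> 1"
          by (intro power_le_one) (auto simp: dist_norm norm_minus_commute)
        then show ?thesis using True \<beta> by (simp add: g_def \<theta>_def ennreal_leI)
      qed simp
    qed
    finally have lowW: "ennreal (\<theta> * W) \<le> (\<integral>\<^sup>+z. g z \<partial>M)" .
    have "(\<integral>\<^sup>+z\<in>G. g z \<partial>M) \<le> (\<integral>\<^sup>+z. indicator (G \<inter> ball a R) z + g z * indicator (- ball a R) z \<partial>M)"
    proof (intro nn_integral_mono)
      fix z
      have "g z \<le> 1" unfolding g_def using \<beta> by simp
      then show "g z * indicator G z \<le> indicator (G \<inter> ball a R) z + g z * indicator (- ball a R) z"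
        by (auto split: split_indicator)
    qed
    also have "\<dots> = emeasure M (G \<inter> ball a R) + (\<integral>\<^sup>+z\<in>- ball a R. g z \<partial>M)"
      using G by (subst nn_integral_add) auto
    also have "\<dots> \<le> ennreal (measure M (G \<inter> ball a R)) + ennreal (\<epsilon> * W)"
    proof (rule add_mono)
      show "emeasure M (G \<inter> ball a R) \<le> ennreal (measure M (G \<inter> ball a R))"
        using G by (simp add: emeasure_M_bounded bounded_Int)
      show "(\<integral>\<^sup>+z\<in>- ball a R. g z \<partial>M) \<le> ennreal (\<epsilon> * W)"
        using tail[of a N] by (simp add: g_def R_def \<epsilon>_def W_def)
    qed
    also have "\<dots> = ennreal (measure M (G \<inter> ball a R) + \<epsilon> * W)"
      using \<epsilon> by (simp add: ennreal_plus W_def)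
    finally have "(\<integral>\<^sup>+z\<in>G. g z \<partial>M) \<le> ennreal (measure M (G \<inter> ball a R) + \<epsilon> * W)" .
    then have "ennreal (\<theta> * W) \<le> ennreal C * ennreal (measure M (G \<inter> ball a R) + \<epsilon> * W)"
      using lowW dG by (meson mult_left_mono order_trans zero_le)
    also have "\<dots> = ennreal (C * (measure M (G \<inter> ball a R) + \<epsilon> * W))"
      using C \<epsilon> by (simp add: ennreal_mult W_def)
    finally have "\<theta> * W \<le> C * (measure M (G \<inter> ball a R) + \<epsilon> * W)"
      using C \<epsilon> by (subst (asm) ennreal_le_iff) (auto simp: W_def)
    moreover have "C * \<epsilon> * W \<le> \<theta> / 2 * W" using \<epsilon> by (intro mult_right_mono) (auto simp: W_def)
    ultimately have "\<theta> / 2 * W \<le> C * measure M (G \<inter> ball a R)" by (simp add: algebra_simps)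
    then have "\<theta> / (2 * C) * W \<le> measure M (G \<inter> ball a R)" using C by (simp add: field_simps)
    \<comment> \<open>Doubling turns the bound relative to the unit disk into one relative to the
      disk of radius R; this is the factor D in \<delta>.\<close>
    moreover have "D * measure M (ball a R) \<le> W"
      using doubling[of 1 R a a] R subset_ball[of 1 R a] by (simp add: D_def W_def)
    then have "\<theta> / (2 * C) * (D * measure M (ball a R)) \<le> \<theta> / (2 * C) * W"
      using \<theta> C by (intro mult_left_mono) auto
    ultimately show "\<delta> * measure M (ball a R) \<le> measure M (G \<inter> ball a R)" by (simp add: \<delta>_def)
  qed
qed

end

theorem theorem1p1:
  fixes p \<alpha> :: real and w :: "complex \<Rightarrow> real" and G :: "complex set"
  assumes "0 < p" and "0 < \<alpha>"
    and "w \<in> Muckenhoupt_infinity"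
    and "G \<in> sets lebesgue"
  shows "dominating_set p \<alpha> w G \<longleftrightarrow>
    (\<exists>R>0. \<exists>\<delta>\<in>{0<..<1}. \<forall>a.
       wmeasure w (G \<inter> ball a R) > ennreal \<delta> * wmeasure w (ball a R))"
proof -
  obtain c q where "A_infinity_weight w c q"
    using Muckenhoupt_infinity_imp_A_infinity_weight[OF assms(3)] .
  then interpret A_infinity_weight w c q .
  have ball_eq: "wmeasure w (ball a R) = ennreal (measure M (ball a R))" for a R
    using emeasure_M[of "ball a R"] emeasure_M_bounded[of "ball a R"] by simp
  have G_eq: "wmeasure w (G \<inter> ball a R) = ennreal (measure M (G \<inter> ball a R))" for a R
    using emeasure_M[of "G \<inter> ball a R"] emeasure_M_bounded[of "G \<inter> ball a R"] assms(4)
    by (simp add: bounded_Int)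
  have iff: "wmeasure w (G \<inter> ball a R) > ennreal \<delta> * wmeasure w (ball a R) \<longleftrightarrow>
      \<delta> * measure M (ball a R) < measure M (G \<inter> ball a R)" if "0 < \<delta>" for a R \<delta>
    unfolding ball_eq G_eq using that by (simp add: ennreal_mult[symmetric] ennreal_less_iff)
  show ?thesis
  proof
    assume "dominating_set p \<alpha> w G"
    then obtain R \<delta> where R: "0 < R" and \<delta>: "0 < \<delta>"
      and d: "\<And>a. \<delta> * measure M (ball a R) \<le> measure M (G \<inter> ball a R)"
      using dense_if_dominating assms(1,2) by metis
    \<comment> \<open>Halving gives the strict inequality, since disks have positive measure, and
      the minimum with 1 keeps \<delta>' below 1.\<close>
    define \<delta>' where "\<delta>' = min \<delta> 1 / 2"
    have \<delta>': "0 < \<delta>'" "\<delta>' < 1" "\<delta>' < \<delta>" using \<delta> by (auto simp: \<delta>'_def)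
    have "\<delta>' * measure M (ball a R) < measure M (G \<inter> ball a R)" for a
      using d[of a] \<delta>'(3) mult_strict_right_mono[OF \<delta>'(3) measure_M_ball_pos[OF R, of a]] by linarith
    then show "\<exists>R>0. \<exists>\<delta>\<in>{0<..<1}. \<forall>a. wmeasure w (G \<inter> ball a R) > ennreal \<delta> * wmeasure w (ball a R)"
      using R \<delta>' by (intro exI[of _ R] conjI bexI[of _ \<delta>']) (auto simp: iff)
  next
    assume "\<exists>R>0. \<exists>\<delta>\<in>{0<..<1}. \<forall>a. wmeasure w (G \<inter> ball a R) > ennreal \<delta> * wmeasure w (ball a R)"
    then obtain R \<delta> where R: "0 < R" and \<delta>: "0 < \<delta>"
      and d: "\<And>a. \<delta> * measure M (ball a R) < measure M (G \<inter> ball a R)"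
      by (auto simp: iff)
    then show "dominating_set p \<alpha> w G"
      using assms by (intro dominating_if_dense[of p \<alpha> R \<delta>] less_imp_le[OF d]) auto
  qed
qed

end
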